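(* Let $r\ge 3$ and $s\ge 12\lceil\log_2 r\rceil$ be integers. Then for every integer $\ell$ with $0\le \ell\le s$, the graph $H_{r,s,\ell}$ is $K_r$-Turán-good but is not $K_{r+1}$-Turán-good.
   Context: All graphs are finite and simple. For $r\ge 3$, $s\ge 4$ and $0\le \ell\le s$, $H_{r,s,\ell}$ is the graph obtained from the complete $(r-1)$-partite graph with parts $A_1,\dots,A_{r-1}$, each of size $s$, by deleting the edges of a matching of size $\ell$ between $A_1$ and $A_2$. $\mathcal N(H,G)$ is the number of (not necessarily induced) subgraphs of $G$ isomorphic to $H$. $T_q(n)$ is the Turán graph: the complete $q$-partite graph on $n$ vertices whose part sizes are $\lfloor n/q\rfloor$ or $\lceil n/q\rceil$. For $q\ge 1$, a graph $H$ is $K_{q+1}$-Turán-good if, for all sufficiently large $n$, $\mathcal N(H,G)\le \mathcal N(H,T_q(n))$ for every $n$-vertex graph $G$ not containing the complete graph $K_{q+1}$ as a subgraph. *)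

theory Defs
  imports Complex_Main
begin

type_synonym 'a ugraph = "'a set \<times> 'a set set"

abbreviation verts :: "'a ugraph \<Rightarrow> 'a set" where "verts \<equiv> fst"
abbreviation edges :: "'a ugraph \<Rightarrow> 'a set set" where "edges \<equiv> snd"

definition simple_graph :: "'a ugraph \<Rightarrow> bool" where
  "simple_graph G \<longleftrightarrow> finite (verts G) \<and> (\<forall>e\<in>edges G. e \<subseteq> verts G \<and> card e = 2)"

definition is_subgraph :: "'a ugraph \<Rightarrow> 'a ugraph \<Rightarrow> bool" where
  "is_subgraph S G \<longleftrightarrow> simple_graph S \<and> verts S \<subseteq> verts G \<and> edges S \<subseteq> edges G"

definition graph_iso :: "'a ugraph \<Rightarrow> 'b ugraph \<Rightarrow> bool" where
  "graph_iso G H \<longleftrightarrow> (\<exists>f. bij_betw f (verts G) (verts H) \<and>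
     (\<forall>u\<in>verts G. \<forall>v\<in>verts G. {u, v} \<in> edges G \<longleftrightarrow> {f u, f v} \<in> edges H))"

definition copies :: "'a ugraph \<Rightarrow> 'b ugraph \<Rightarrow> 'b ugraph set" where
  "copies H G = {S. is_subgraph S G \<and> graph_iso H S}"

definition num_copies :: "'a ugraph \<Rightarrow> 'b ugraph \<Rightarrow> nat" where
  "num_copies H G = card (copies H G)"

definition complete_graph :: "nat \<Rightarrow> nat ugraph" where
  "complete_graph k = ({..<k}, {e. e \<subseteq> {..<k} \<and> card e = 2})"

text \<open>The parts are the fibres of \<open>c\<close> on \<open>V\<close>.\<close>

definition complete_multipartite :: "'a set \<Rightarrow> ('a \<Rightarrow> 'b) \<Rightarrow> 'a ugraph" where
  "complete_multipartite V c = (V, {{u, v} | u v. u \<in> V \<and> v \<in> V \<and> c u \<noteq> c v})"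

definition turan_graph :: "nat \<Rightarrow> nat \<Rightarrow> nat ugraph" where
  "turan_graph q n = complete_multipartite {..<n} (\<lambda>v. v mod q)"

text \<open>
  \<open>turan_good q H\<close> says that \<open>H\<close> is \<open>K\<^sub>q\<^sub>+\<^sub>1\<close>-Turan-good (for \<open>q \<ge> 1\<close>). Every finite graph has
  an isomorphic copy with vertices in \<open>nat\<close>, so it is enough to let \<open>G\<close> range over those.
\<close>

definition turan_good :: "nat \<Rightarrow> 'a ugraph \<Rightarrow> bool" where
  "turan_good q H \<longleftrightarrow> (\<forall>\<^sub>F n in sequentially. \<forall>G :: nat ugraph.
     simple_graph G \<and> card (verts G) = n \<and> copies (complete_graph (q + 1)) G = {} \<longrightarrow>
     num_copies H G \<le> num_copies H (turan_graph q n))"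

text \<open>
  The part \<open>A\<^sub>i\<close> is \<open>{(i - 1, j) | j. j < s}\<close>, and the deleted matching consists of the edges
  joining the \<open>j\<close>-th vertices of \<open>A\<^sub>1\<close> and \<open>A\<^sub>2\<close> for \<open>j < l\<close>; any other matching of size \<open>l\<close>
  between these two parts gives an isomorphic graph.
\<close>

definition H_graph :: "nat \<Rightarrow> nat \<Rightarrow> nat \<Rightarrow> (nat \<times> nat) ugraph" where
  "H_graph r s l =
     (let K = complete_multipartite ({..<r - 1} \<times> {..<s}) fst
      in (verts K, edges K - {{(0, j), (1, j)} | j. j < l}))"

lemma simple_graph_complete_multipartite:
  assumes "finite V"
  shows "simple_graph (complete_multipartite V c)"
  using assms by (auto simp: simple_graph_def complete_multipartite_def card_2_iff)

lemma simple_graph_turan_graph: "simple_graph (turan_graph q n)"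
  by (simp add: turan_graph_def simple_graph_complete_multipartite)

lemma simple_graph_H_graph: "simple_graph (H_graph r s l)"
  using simple_graph_complete_multipartite[of "{..<r - 1} \<times> {..<s}" fst]
  by (auto simp: simple_graph_def H_graph_def Let_def)

lemma turan_graph_part_size:
  assumes "i < q"
  shows "int (card {v \<in> verts (turan_graph q n). v mod q = i}) \<in>
           {\<lfloor>real n / real q\<rfloor>, \<lceil>real n / real q\<rceil>}"
proof -
  define k where "k = n div q"
  define m where "m = n mod q"
  have q: "q > 0" using assms by simp
  have n: "n = k * q + m" and m: "m < q" using q by (simp_all add: k_def m_def)
  define t where "t = (if i < m then k + 1 else k)"
  have "{v. v < n \<and> v mod q = i} = (\<lambda>a. a * q + i) ` {..<t}"
  proof (intro equalityI subsetI)
    fix v assume "v \<in> {v. v < n \<and> v mod q = i}"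
    then have v: "v < n" "v = (v div q) * q + i" by auto
    have "v div q < t"
    proof (rule ccontr)
      assume "\<not> v div q < t"
      then have le: "t * q \<le> (v div q) * q" by simp
      have "n \<le> t * q + i"
        using n m by (auto simp: t_def)
      with v le show False by linarith
    qed
    with v(2) show "v \<in> (\<lambda>a. a * q + i) ` {..<t}" by blast
  next
    fix v assume "v \<in> (\<lambda>a. a * q + i) ` {..<t}"
    then obtain a where a: "a < t" "v = a * q + i" by auto
    have "v < n"
    proof (cases "a < k")
      case True
      then have "Suc a * q \<le> k * q" by (intro mult_le_mono) auto
      then show ?thesis using a n assms by simp
    next
      case False
      then have "a = k" "i < m" using a by (auto simp: t_def split: if_splits)
      then show ?thesis using a n by simp
    qed
    then show "v \<in> {v. v < n \<and> v mod q = i}" using a assms by simp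
  qed
  moreover have "inj_on (\<lambda>a. a * q + i) {..<t}" using q by (auto simp: inj_on_def)
  ultimately have "card {v. v < n \<and> v mod q = i} = t" by (simp add: card_image)
  moreover have "\<lfloor>real n / real q\<rfloor> = int k"
    unfolding k_def by (simp add: floor_divide_of_nat_eq)
  moreover have "\<lceil>real n / real q\<rceil> = int k + 1" if "i < m"
    using that m q n by (intro ceiling_unique) (auto simp: field_simps)
  ultimately show ?thesis
    by (auto simp: turan_graph_def complete_multipartite_def t_def)
qed

end

theory Submission
  imports Defs "HOL-Library.FuncSet"
begin

text \<open>
  Put \<open>q = r - 1\<close> and count embeddings of \<open>H = H_graph r s l\<close>, i.e. copies times automorphisms.

  Upper bound for graphs \<open>G\<close> without a clique on \<open>q + 1\<close> vertices: \<open>H\<close> has a factor of \<open>s\<close> cliques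
  of size \<open>q\<close>. The images of these cliques form a tuple of disjoint \<open>q\<close>-cliques of \<open>G\<close>, and
  together with the restriction to one of them this tuple determines the embedding, so there are
  at most \<open>q!\<close> embeddings per tuple. Removing a \<open>q\<close>-clique from a Turan graph leaves a Turan
  graph, so Zykov's bound on the number of \<open>q\<close>-cliques, applied \<open>s\<close> times, shows that the Turan
  graph has the most tuples; and there every tuple is attained \<open>q!\<close> times.

  Failure for \<open>r\<close> parts: embeddings into the Turan graph with \<open>r\<close> parts are governed by proper
  \<open>r\<close>-colourings of \<open>H\<close>. There are at most \<open>r! r 2^s\<close> of these, and \<open>r^2 2^s < (r / q)^(s q)\<close>, because
  \<open>(1 + 1/q)^q \<ge> 9/4\<close> and \<open>(9/8)^12 > 4\<close>. So the Turan graph with \<open>q\<close> parts contains more copies.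
\<close>

section \<open>Cliques in graphs of bounded clique number\<close>

text \<open>The adjacency relation is kept apart from the vertex set, so that deleting vertices only
  shrinks \<open>V\<close>. \<open>pairwise\<close> ignores the diagonal.\<close>

definition cliques :: "('a \<Rightarrow> 'a \<Rightarrow> bool) \<Rightarrow> 'a set \<Rightarrow> nat \<Rightarrow> 'a set set" where
  "cliques E V t = {R. R \<subseteq> V \<and> card R = t \<and> pairwise E R}"

lemma finite_cliques: "finite V \<Longrightarrow> finite (cliques E V t)"
  by (rule finite_subset[of _ "Pow V"]) (auto simp: cliques_def)

lemma cliques_mono: "V \<subseteq> W \<Longrightarrow> E \<le> F \<Longrightarrow> cliques E V t \<subseteq> cliques F W t"
  unfolding cliques_def pairwise_def le_fun_def by auto

text \<open>A clique splits into its part \<open>R\<close> outside \<open>Q\<close> and its part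
  inside \<open>Q\<close>. Since \<open>Q\<close> is a clique, the latter can be any set of common
  neighbours of \<open>R\<close> in \<open>Q\<close> of the right size. The identity is applied to
  an arbitrary graph and to the Turan graph, which are then compared summand by summand.\<close>

lemma card_cliques_split:
  assumes V: "finite V" and Q: "Q \<subseteq> V" "pairwise E Q" and E: "symp E"
  shows "card (cliques E V t) =
    (\<Sum>u\<le>t. \<Sum>R\<in>cliques E (V - Q) u. card {x \<in> Q. \<forall>y\<in>R. E x y} choose (t - u))"
proof -
  define N where "N R = {x \<in> Q. \<forall>y\<in>R. E x y}" for R
  define P where "P = (SIGMA u:{..t}. SIGMA R:cliques E (V - Q) u. {S. S \<subseteq> N R \<and> card S = t - u})"
  have finQ: "finite Q" using V Q finite_subset by blast
  have finN: "finite (N R)" for R using finQ by (simp add: N_def)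
  have "bij_betw (\<lambda>T. (card (T - Q), T - Q, T \<inter> Q)) (cliques E V t) P"
  proof (rule bij_betw_byWitness[where f' = "\<lambda>(u, R, S). R \<union> S"])
    show "\<forall>T\<in>cliques E V t. (case (card (T - Q), T - Q, T \<inter> Q) of (u, R, S) \<Rightarrow> R \<union> S) = T"
      by auto
    show "\<forall>p\<in>P. (\<lambda>T. (card (T - Q), T - Q, T \<inter> Q)) (case p of (u, R, S) \<Rightarrow> R \<union> S) = p"
    proof
      fix p assume "p \<in> P"
      then obtain u R S where p: "p = (u, R, S)" and "(u, R, S) \<in> P"
        by (metis prod_cases3)
      then have "R \<subseteq> V - Q" "card R = u" "S \<subseteq> Q"
        unfolding P_def cliques_def N_def by auto
      moreover have "R \<union> S - Q = R" "(R \<union> S) \<inter> Q = S" using calculation by auto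
      ultimately show "(\<lambda>T. (card (T - Q), T - Q, T \<inter> Q)) (case p of (u, R, S) \<Rightarrow> R \<union> S) = p"
        using p by simp
    qed
    show "(\<lambda>T. (card (T - Q), T - Q, T \<inter> Q)) ` cliques E V t \<subseteq> P"
    proof (intro image_subsetI)
      fix T assume T: "T \<in> cliques E V t"
      then have fT: "finite T" using V finite_subset unfolding cliques_def by blast
      have "card T = card (T - Q) + card (T \<inter> Q)"
        using fT card_Diff_subset_Int[of T Q] card_mono[of T "T \<inter> Q"] by simp
      moreover have "T \<inter> Q \<subseteq> N (T - Q)" using T unfolding N_def cliques_def pairwise_def by auto
      ultimately show "(card (T - Q), T - Q, T \<inter> Q) \<in> P"
        using T unfolding P_def cliques_def by (auto simp: pairwise_def)
    qed
    show "(\<lambda>(u, R, S). R \<union> S) ` P \<subseteq> cliques E V t"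
    proof (intro image_subsetI)
      fix p assume "p \<in> P"
      then obtain u R S where p: "p = (u, R, S)" and u: "u \<le> t" and R: "R \<subseteq> V - Q" "card R = u" "pairwise E R"
        and S: "S \<subseteq> N R" "card S = t - u"
        unfolding P_def cliques_def by auto
      have fin: "finite R" "finite S" using R(1) S(1) V finN by (meson finite_Diff finite_subset)+
      have "R \<inter> S = {}" using R S unfolding N_def by auto
      then have "card (R \<union> S) = t" using card_Un_disjoint[OF fin] R S u by simp
      moreover have "pairwise E (R \<union> S)"
        unfolding pairwise_def
      proof (intro ballI impI)
        fix x y assume xy: "x \<in> R \<union> S" "y \<in> R \<union> S" "x \<noteq> y"
        then consider "x \<in> R" "y \<in> R" | "x \<in> S" "y \<in> S" | "x \<in> S" "y \<in> R" | "x \<in> R" "y \<in> S" by auto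
        then show "E x y"
        proof cases
          case 1 then show ?thesis using R xy by (auto simp: pairwise_def)
        next
          case 2 then show ?thesis using S(1) pairwiseD[OF Q(2)] xy(3) unfolding N_def by blast
        next
          case 3 then show ?thesis using S by (auto simp: N_def)
        next
          case 4 then have "E y x" using S by (auto simp: N_def)
          then show ?thesis using E by (rule sympD[rotated])
        qed
      qed
      ultimately show "(case p of (u, R, S) \<Rightarrow> R \<union> S) \<in> cliques E V t"
        using R S Q p unfolding cliques_def N_def by auto
    qed
  qed
  then have "card (cliques E V t) = card P" by (rule bij_betw_same_card)
  also have "\<dots> = (\<Sum>u\<le>t. \<Sum>R\<in>cliques E (V - Q) u. card {S. S \<subseteq> N R \<and> card S = t - u})"
  proof -
    have "finite {S. S \<subseteq> N R \<and> card S = k}" for R k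
      by (rule finite_subset[of _ "Pow (N R)"]) (use finN in auto)
    moreover have "finite (cliques E (V - Q) u)" for u using V by (simp add: finite_cliques)
    ultimately show ?thesis
      unfolding P_def by (subst card_SigmaI; simp)
  qed
  also have "\<dots> = (\<Sum>u\<le>t. \<Sum>R\<in>cliques E (V - Q) u. card (N R) choose (t - u))"
    using n_subsets[OF finN] by simp
  finally show ?thesis by (simp add: N_def)
qed

text \<open>
  Joining two vertices of a graph without \<open>q\<close>-clique creates no clique with \<open>q + 1\<close> vertices, so
  an edge-maximal graph without such a clique is complete or contains a \<open>q\<close>-clique.
\<close>

lemma saturated_supergraph:
  assumes "finite V" "symp E" "cliques E V (Suc q) = {}"
  obtains F where "symp F" "E \<le> F" "cliques F V (Suc q) = {}" "cliques F V q \<noteq> {} \<or> pairwise F V"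
proof -
  have "\<exists>F. symp F \<and> E \<le> F \<and> cliques F V (Suc q) = {} \<and> (cliques F V q \<noteq> {} \<or> pairwise F V)"
    using assms
  proof (induction "card {(x, y) \<in> V \<times> V. x \<noteq> y \<and> \<not> E x y}" arbitrary: E rule: less_induct)
    case less
    show ?case
    proof (cases "cliques E V q \<noteq> {} \<or> pairwise E V")
      case True
      then show ?thesis using less.prems by blast
    next
      case False
      then obtain a b where ab: "a \<in> V" "b \<in> V" "a \<noteq> b" "\<not> E a b"
        unfolding pairwise_def by blast
      define F where "F x y \<longleftrightarrow> E x y \<or> x = a \<and> y = b \<or> x = b \<and> y = a" for x y
      have sF: "symp F" using less.prems(2) unfolding symp_def F_def by blast
      have EF: "E \<le> F" unfolding F_def by auto
      have free: "cliques F V (Suc q) = {}"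
      proof (rule ccontr)
        assume "cliques F V (Suc q) \<noteq> {}"
        then obtain R where R: "R \<subseteq> V" "card R = Suc q" "pairwise F R" unfolding cliques_def by auto
        \<comment> \<open>Every pair gained by \<open>F\<close> contains \<open>a\<close>, so
          \<open>R\<close> without \<open>a\<close> would be a \<open>q\<close>-clique for
          \<open>E\<close>, which this case excludes.\<close>
        have "pairwise E (R - {a})" using R(3) unfolding pairwise_def F_def by blast
        moreover have "a \<in> R"
        proof (rule ccontr)
          assume "a \<notin> R"
          then have "pairwise E R" using R(3) unfolding pairwise_def F_def by blast
          then show False using R less.prems(3) unfolding cliques_def by auto
        qed
        ultimately have "R - {a} \<in> cliques E V q" using R unfolding cliques_def by auto
        then show False using False by auto
      qed
      have "card {(x, y) \<in> V \<times> V. x \<noteq> y \<and> \<not> F x y} < card {(x, y) \<in> V \<times> V. x \<noteq> y \<and> \<not> E x y}"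
      proof (rule psubset_card_mono)
        show "finite {(x, y) \<in> V \<times> V. x \<noteq> y \<and> \<not> E x y}"
          by (rule finite_subset[of _ "V \<times> V"]) (use less.prems in auto)
        show "{(x, y) \<in> V \<times> V. x \<noteq> y \<and> \<not> F x y} \<subset> {(x, y) \<in> V \<times> V. x \<noteq> y \<and> \<not> E x y}"
          using ab unfolding F_def by auto
      qed
      from less.hyps[OF this less.prems(1) sF free] EF show ?thesis by (meson order_trans)
    qed
  qed
  then show ?thesis using that by blast
qed

lemma card_distinct_residues:
  fixes q :: nat
  assumes "finite R" "pairwise (\<lambda>x y. x mod q \<noteq> y mod q) R"
  shows "card ((\<lambda>x. x mod q) ` R) = card R"
  using assms by (intro card_image) (auto simp: inj_on_def pairwise_def)

lemma image_filter_diff: "f ` {x \<in> C. \<forall>y\<in>R. f x \<noteq> f y} = f ` C - f ` R"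
  by auto

text \<open>Zykov's theorem, by removing a \<open>q\<close>-clique from both graphs at once. A
  clique with \<open>u\<close> vertices outside a \<open>q\<close>-clique \<open>Q\<close> has at
  most \<open>q - u\<close> common neighbours in \<open>Q\<close>; in the Turan graph equality
  holds. The remaining vertices are handled by induction.\<close>

lemma card_cliques_le_turan:
  assumes "finite V" "symp E" "cliques E V (Suc q) = {}" "q > 0"
  shows "card (cliques E V t) \<le> card (cliques (\<lambda>x y. x mod q \<noteq> y mod q) {..<card V} t)"
  using assms
proof (induction "card V" arbitrary: V E t rule: less_induct)
  case less
  define T :: "nat \<Rightarrow> nat \<Rightarrow> bool" where "T x y \<longleftrightarrow> x mod q \<noteq> y mod q" for x y
  define n where "n = card V"
  have symT: "symp T" unfolding T_def symp_def by auto
  obtain F where F: "symp F" "E \<le> F" "cliques F V (Suc q) = {}" "cliques F V q \<noteq> {} \<or> pairwise F V"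
    using saturated_supergraph[OF less.prems(1-3)] by metis
  have "card (cliques E V t) \<le> card (cliques F V t)"
    using less.prems(1) F(2) by (intro card_mono finite_cliques cliques_mono) auto
  also have "\<dots> \<le> card (cliques T {..<n} t)"
  proof (cases "cliques F V q = {}")
    case True
    then have "pairwise F V" using F(4) by auto
    \<comment> \<open>A complete graph without a \<open>q\<close>-clique is this small, and below
      \<open>q\<close> vertices the Turan graph is complete too.\<close>
    have "n < q"
    proof (rule ccontr)
      assume "\<not> n < q"
      then obtain R where "R \<subseteq> V" "card R = q" unfolding n_def by (meson not_less obtain_subset_with_card_n)
      then have "R \<in> cliques F V q" using \<open>pairwise F V\<close> unfolding cliques_def pairwise_def by auto
      then show False using True by auto
    qed
    have "T x y" if "x \<in> {..<n}" "y \<in> {..<n}" "x \<noteq> y" for x y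
      using that \<open>n < q\<close> unfolding T_def by simp
    then have "cliques T {..<n} t = {R. R \<subseteq> {..<n} \<and> card R = t}"
      unfolding cliques_def pairwise_def by blast
    then have "card (cliques T {..<n} t) = n choose t" by (simp add: n_subsets)
    moreover have "card (cliques F V t) \<le> card {R. R \<subseteq> V \<and> card R = t}"
      using less.prems(1) by (intro card_mono) (auto simp: cliques_def)
    moreover have "\<dots> = n choose t" using less.prems(1) by (simp add: n_subsets n_def)
    ultimately show ?thesis by simp
  next
    case False
    then obtain Q where Q: "Q \<subseteq> V" "card Q = q" "pairwise F Q" unfolding cliques_def by auto
    have finQ: "finite Q" using Q(1) less.prems(1) finite_subset by blast
    have qn: "q \<le> n" using Q card_mono[OF less.prems(1)] unfolding n_def by blast
    \<comment> \<open>The last \<open>q\<close> vertices contain each residue once, hence form a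
      clique, and what remains is the Turan graph on \<open>n - q\<close> vertices.\<close>
    define C where "C = {n - q..<n}"
    have C: "C \<subseteq> {..<n}" "{..<n} - C = {..<n - q}" "card C = q"
      using qn unfolding C_def by auto
    have inj: "inj_on (\<lambda>x. x mod q) C"
    proof -
      have le: "x \<le> y" if "x \<in> C" "y \<in> C" "x mod q = y mod q" for x y
      proof (rule ccontr)
        assume "\<not> x \<le> y"
        then have "q dvd x - y" using that(3) mod_eq_dvd_iff_nat[of y x q] by linarith
        moreover have "0 < x - y" "x - y < q"
          using that(1,2) \<open>\<not> x \<le> y\<close> unfolding C_def atLeastLessThan_iff by linarith+
        ultimately show False using nat_dvd_not_less by blast
      qed
      then show ?thesis by (metis inj_onI antisym)
    qed
    have resC: "(\<lambda>x. x mod q) ` C = {..<q}"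
      using less.prems(4) C(3) card_image[OF inj] by (intro card_subset_eq) auto
    have pairC: "pairwise T C" using inj unfolding pairwise_def T_def inj_on_def by blast
    have cardV: "card (V - Q) = n - q" using Q finQ unfolding n_def by (simp add: card_Diff_subset)
    have "card (cliques F V t) =
       (\<Sum>u\<le>t. \<Sum>R\<in>cliques F (V - Q) u. card {x \<in> Q. \<forall>y\<in>R. F x y} choose (t - u))"
      by (rule card_cliques_split[OF less.prems(1) Q(1,3) F(1)])
    also have "\<dots> \<le> (\<Sum>u\<le>t. \<Sum>R\<in>cliques F (V - Q) u. (q - u) choose (t - u))"
    proof (intro sum_mono binomial_right_mono)
      fix u R assume R: "R \<in> cliques F (V - Q) u"
      define N where "N = {x \<in> Q. \<forall>y\<in>R. F x y}"
      have fin: "finite R" "finite N" using R less.prems(1) finQ finite_subset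
        unfolding cliques_def N_def by auto
      have card: "card (R \<union> N) = u + card N"
        using R by (subst card_Un_disjoint[OF fin]) (auto simp: cliques_def N_def)
      have pair: "pairwise F (R \<union> N)"
        using R Q(3) sympD[OF F(1)] unfolding cliques_def N_def pairwise_def by auto
      have sub: "R \<union> N \<subseteq> V" using R Q unfolding cliques_def N_def by auto
      \<comment> \<open>\<open>R\<close> and its common neighbours in \<open>Q\<close> together form
        a clique.\<close>
      have "card (R \<union> N) \<le> q"
      proof (rule ccontr)
        assume "\<not> card (R \<union> N) \<le> q"
        then obtain W where W: "W \<subseteq> R \<union> N" "card W = Suc q"
          by (meson not_less_eq_eq obtain_subset_with_card_n)
        then have "W \<in> cliques F V (Suc q)"
          using sub pairwise_subset[OF pair W(1)] unfolding cliques_def by auto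
        then show False using F(3) by auto
      qed
      then show "card {x \<in> Q. \<forall>y\<in>R. F x y} \<le> q - u" using card unfolding N_def by linarith
    qed
    also have "\<dots> = (\<Sum>u\<le>t. card (cliques F (V - Q) u) * ((q - u) choose (t - u)))" by simp
    also have "\<dots> \<le> (\<Sum>u\<le>t. card (cliques T {..<n - q} u) * ((q - u) choose (t - u)))"
    proof (intro sum_mono mult_right_mono)
      fix u
      have "cliques F (V - Q) (Suc q) = {}" using F(3) cliques_mono[of "V - Q" V F F] by auto
      moreover have "card (V - Q) < card V" using cardV qn less.prems(4) unfolding n_def by simp
      ultimately show "card (cliques F (V - Q) u) \<le> card (cliques T {..<n - q} u)"
        using less.hyps[of "V - Q" F u] less.prems F(1) cardV unfolding T_def by simp
    qed auto
    also have "\<dots> = (\<Sum>u\<le>t. \<Sum>R\<in>cliques T {..<n - q} u. (q - u) choose (t - u))" by simp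
    also have "\<dots> = (\<Sum>u\<le>t. \<Sum>R\<in>cliques T ({..<n} - C) u. card {x \<in> C. \<forall>y\<in>R. T x y} choose (t - u))"
    proof (intro sum.cong refl)
      show "cliques T {..<n - q} u = cliques T ({..<n} - C) u" for u using C by simp
      fix u R assume "R \<in> cliques T ({..<n} - C) u"
      then have R: "finite R" "card R = u" "pairwise T R"
        unfolding cliques_def by (auto intro: finite_subset)
      \<comment> \<open>Residues are distinct on \<open>C\<close>, so counting common neighbours
        amounts to counting the residues that \<open>R\<close> misses.\<close>
      have "card ((\<lambda>x. x mod q) ` {x \<in> C. \<forall>y\<in>R. T x y}) = card {x \<in> C. \<forall>y\<in>R. T x y}"
        by (rule card_image) (rule inj_on_subset[OF inj], blast)
      moreover have "(\<lambda>x. x mod q) ` {x \<in> C. \<forall>y\<in>R. T x y} = {..<q} - (\<lambda>x. x mod q) ` R"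
        using image_filter_diff[of "\<lambda>x. x mod q" C R] unfolding resC T_def by simp
      moreover have "card ({..<q} - (\<lambda>x. x mod q) ` R) = q - u"
      proof -
        have "card ((\<lambda>x. x mod q) ` R) = u"
          using card_distinct_residues[of R q] R unfolding T_def by blast
        moreover have "(\<lambda>x. x mod q) ` R \<subseteq> {..<q}" using less.prems(4) by auto
        ultimately show ?thesis using R(1) by (simp add: card_Diff_subset)
      qed
      ultimately show "(q - u) choose (t - u) = card {x \<in> C. \<forall>y\<in>R. T x y} choose (t - u)" by simp
    qed
    also have "\<dots> = card (cliques T {..<n} t)"
      by (rule card_cliques_split[OF _ C(1) pairC symT, symmetric]) simp
    finally show ?thesis .
  qed
  finally show ?case unfolding T_def n_def .
qed

section \<open>Copies and embeddings\<close>

text \<open>Extensional maps are determined by their values on \<open>verts H\<close>, so they can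
  be counted.\<close>

definition embeddings :: "'a ugraph \<Rightarrow> 'b ugraph \<Rightarrow> ('a \<Rightarrow> 'b) set" where
  "embeddings H G = {f \<in> verts H \<rightarrow>\<^sub>E verts G. inj_on f (verts H) \<and>
     (\<forall>u\<in>verts H. \<forall>v\<in>verts H. {u, v} \<in> edges H \<longrightarrow> {f u, f v} \<in> edges G)}"

text \<open>\<open>isos H H\<close> is the automorphism group of \<open>H\<close>.\<close>

definition isos :: "'a ugraph \<Rightarrow> 'b ugraph \<Rightarrow> ('a \<Rightarrow> 'b) set" where
  "isos H S = {f \<in> extensional (verts H). bij_betw f (verts H) (verts S) \<and>
     (\<forall>u\<in>verts H. \<forall>v\<in>verts H. {u, v} \<in> edges H \<longleftrightarrow> {f u, f v} \<in> edges S)}"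

lemma simple_graph_edgeE:
  assumes "simple_graph G" "e \<in> edges G"
  obtains u v where "e = {u, v}" "u \<noteq> v" "u \<in> verts G" "v \<in> verts G"
proof -
  have "e \<subseteq> verts G" "card e = 2" using assms unfolding simple_graph_def by auto
  then show ?thesis using that by (auto simp: card_2_iff)
qed

lemma embeddings_edge:
  "f \<in> embeddings H G \<Longrightarrow> {u, v} \<in> edges H \<Longrightarrow> u \<in> verts H \<Longrightarrow> v \<in> verts H \<Longrightarrow> {f u, f v} \<in> edges G"
  unfolding embeddings_def by blast

lemma finite_embeddings:
  assumes "simple_graph H" "simple_graph G"
  shows "finite (embeddings H G)"
proof (rule finite_subset)
  show "embeddings H G \<subseteq> verts H \<rightarrow>\<^sub>E verts G" unfolding embeddings_def by auto
  show "finite (verts H \<rightarrow>\<^sub>E verts G)"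
    using assms unfolding simple_graph_def by (intro finite_PiE) auto
qed

lemma finite_copies:
  assumes "simple_graph G"
  shows "finite (copies H G)"
proof (rule finite_subset)
  show "copies H G \<subseteq> Pow (verts G) \<times> Pow (edges G)"
    unfolding copies_def is_subgraph_def by auto
  have "edges G \<subseteq> Pow (verts G)" using assms unfolding simple_graph_def by auto
  then show "finite (Pow (verts G) \<times> Pow (edges G))"
    using assms unfolding simple_graph_def by (auto intro: finite_subset)
qed

text \<open>An isomorphism determines its target. Hence an embedding belongs to only one copy, which
  gives the disjointness in \<open>card_embeddings\<close>.\<close>

lemma iso_image:
  assumes H: "simple_graph H" and S: "simple_graph S" and f: "f \<in> isos H S"
  shows "S = (f ` verts H, (`) f ` edges H)"
proof -
  have bij: "bij_betw f (verts H) (verts S)"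
    and iff: "\<And>u v. u \<in> verts H \<Longrightarrow> v \<in> verts H \<Longrightarrow> {u, v} \<in> edges H \<longleftrightarrow> {f u, f v} \<in> edges S"
    using f unfolding isos_def by auto
  have "edges S = (`) f ` edges H"
  proof (intro equalityI subsetI)
    fix e assume e: "e \<in> edges S"
    then obtain x y where xy: "e = {x, y}" "x \<in> verts S" "y \<in> verts S"
      using simple_graph_edgeE[OF S] by metis
    then obtain u v where uv: "u \<in> verts H" "v \<in> verts H" "x = f u" "y = f v"
      using bij unfolding bij_betw_def by (metis imageE)
    then have "{u, v} \<in> edges H" using iff e xy by auto
    then show "e \<in> (`) f ` edges H" using xy uv by (intro image_eqI[of _ _ "{u, v}"]) auto
  next
    fix e assume "e \<in> (`) f ` edges H"
    then obtain d where d: "d \<in> edges H" "e = f ` d" by auto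
    then obtain u v where "d = {u, v}" "u \<in> verts H" "v \<in> verts H"
      using simple_graph_edgeE[OF H] by metis
    then show "e \<in> edges S" using iff d by auto
  qed
  then show ?thesis using bij unfolding bij_betw_def by (simp add: prod_eq_iff)
qed

text \<open>An embedding is an isomorphism onto the subgraph formed by the images of the vertices
  and edges of \<open>H\<close>. Further edges of \<open>G\<close> between image vertices are left
  out, because copies may be non-induced.\<close>

lemma embeddings_eq_UN_isos:
  assumes H: "simple_graph H" and G: "simple_graph G"
  shows "embeddings H G = (\<Union>S\<in>copies H G. isos H S)"
proof (intro equalityI subsetI)
  fix f assume f: "f \<in> embeddings H G"
  then have fV: "f \<in> verts H \<rightarrow>\<^sub>E verts G" and inj: "inj_on f (verts H)"
    and hom: "\<And>u v. u \<in> verts H \<Longrightarrow> v \<in> verts H \<Longrightarrow> {u, v} \<in> edges H \<Longrightarrow> {f u, f v} \<in> edges G"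
    unfolding embeddings_def by auto
  define S where "S = (f ` verts H, (`) f ` edges H)"
  have edge: "\<exists>u v. e = {f u, f v} \<and> {u, v} \<in> edges H \<and> f u \<noteq> f v \<and> u \<in> verts H \<and> v \<in> verts H"
    if "e \<in> edges S" for e
  proof -
    obtain d where d: "d \<in> edges H" "e = f ` d" using \<open>e \<in> edges S\<close> unfolding S_def by auto
    obtain u v where "d = {u, v}" "u \<noteq> v" "u \<in> verts H" "v \<in> verts H"
      using simple_graph_edgeE[OF H d(1)] by metis
    then show ?thesis using d inj unfolding inj_on_def by auto
  qed
  have "simple_graph S"
    unfolding simple_graph_def
  proof (intro conjI ballI)
    show "finite (verts S)" using H unfolding S_def simple_graph_def by simp
    show "e \<subseteq> verts S" if "e \<in> edges S" for e using edge[OF that] unfolding S_def by auto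
    show "card e = 2" if "e \<in> edges S" for e using edge[OF that] by auto
  qed
  moreover have "edges S \<subseteq> edges G" using edge hom by blast
  moreover have "verts S \<subseteq> verts G" using fV unfolding S_def by auto
  ultimately have sub: "is_subgraph S G" unfolding is_subgraph_def by auto
  have "{u, v} \<in> edges H \<longleftrightarrow> {f u, f v} \<in> edges S" if "u \<in> verts H" "v \<in> verts H" for u v
  proof
    assume "{u, v} \<in> edges H"
    then show "{f u, f v} \<in> edges S"
      unfolding S_def by (auto intro!: image_eqI[of _ _ "{u, v}"])
  next
    assume "{f u, f v} \<in> edges S"
    then obtain d where d: "d \<in> edges H" "f ` {u, v} = f ` d" unfolding S_def by auto
    have "d \<subseteq> verts H" using d(1) H unfolding simple_graph_def by auto
    then have "{u, v} = d" using inj_on_image_eq_iff[OF inj, of "{u, v}" d] d(2) that by auto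
    then show "{u, v} \<in> edges H" using d by simp
  qed
  moreover have "bij_betw f (verts H) (verts S)" using inj unfolding S_def bij_betw_def by simp
  moreover have "f \<in> extensional (verts H)" using fV by (simp add: PiE_def)
  ultimately have "f \<in> isos H S" and "graph_iso H S" unfolding isos_def graph_iso_def by auto
  then show "f \<in> (\<Union>S\<in>copies H G. isos H S)" using sub unfolding copies_def by blast
next
  fix f assume "f \<in> (\<Union>S\<in>copies H G. isos H S)"
  then obtain S where S: "is_subgraph S G" "f \<in> isos H S" unfolding copies_def by auto
  then show "f \<in> embeddings H G"
    unfolding embeddings_def isos_def is_subgraph_def bij_betw_def by (auto simp: PiE_def)
qed

text \<open>Composing with one fixed isomorphism from \<open>H\<close> to \<open>S\<close> turns
  automorphisms of \<open>H\<close> into isomorphisms onto \<open>S\<close>; its inverse leads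
  back.\<close>

lemma card_isos:
  assumes "graph_iso H S"
  shows "card (isos H S) = card (isos H H)"
proof -
  obtain g where bij: "bij_betw g (verts H) (verts S)"
    and iff: "\<And>u v. u \<in> verts H \<Longrightarrow> v \<in> verts H \<Longrightarrow> {u, v} \<in> edges H \<longleftrightarrow> {g u, g v} \<in> edges S"
    using assms unfolding graph_iso_def by auto
  define k where "k = inv_into (verts H) g"
  have kbij: "bij_betw k (verts S) (verts H)" unfolding k_def using bij by (rule bij_betw_inv_into)
  have kg: "k (g x) = x" if "x \<in> verts H" for x
    using that bij unfolding k_def by (simp add: bij_betw_inv_into_left)
  have gk: "g (k x) = x" if "x \<in> verts S" for x
    using that bij unfolding k_def by (simp add: bij_betw_inv_into_right)
  have kV: "k x \<in> verts H" if "x \<in> verts S" for x using kbij that by (auto simp: bij_betw_def)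
  have kiff: "{u, v} \<in> edges S \<longleftrightarrow> {k u, k v} \<in> edges H" if "u \<in> verts S" "v \<in> verts S" for u v
    using iff[of "k u" "k v"] that gk kV by simp
  have "bij_betw (\<lambda>h. restrict (g \<circ> h) (verts H)) (isos H H) (isos H S)"
  proof (rule bij_betw_byWitness[where f' = "\<lambda>h. restrict (k \<circ> h) (verts H)"])
    show "\<forall>h\<in>isos H H. restrict (k \<circ> restrict (g \<circ> h) (verts H)) (verts H) = h"
      by (auto simp: isos_def fun_eq_iff kg bij_betwE extensional_def)
    show "\<forall>h\<in>isos H S. restrict (g \<circ> restrict (k \<circ> h) (verts H)) (verts H) = h"
      by (auto simp: isos_def fun_eq_iff gk bij_betwE extensional_def)
    show "(\<lambda>h. restrict (g \<circ> h) (verts H)) ` isos H H \<subseteq> isos H S"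
    proof (intro image_subsetI)
      fix h assume h: "h \<in> isos H H"
      then have hb: "bij_betw h (verts H) (verts H)" unfolding isos_def by auto
      have "bij_betw (restrict (g \<circ> h) (verts H)) (verts H) (verts S)"
        using bij_betw_trans[OF hb bij] by (simp cong: bij_betw_cong)
      moreover have "h x \<in> verts H" if "x \<in> verts H" for x using hb that by (auto simp: bij_betw_def)
      moreover have "{u, v} \<in> edges H \<longleftrightarrow> {g (h u), g (h v)} \<in> edges S"
        if "u \<in> verts H" "v \<in> verts H" for u v
        using h iff[of "h u" "h v"] calculation(2) that unfolding isos_def by blast
      ultimately show "restrict (g \<circ> h) (verts H) \<in> isos H S"
        unfolding isos_def by simp
    qed
    show "(\<lambda>h. restrict (k \<circ> h) (verts H)) ` isos H S \<subseteq> isos H H"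
    proof (intro image_subsetI)
      fix h assume h: "h \<in> isos H S"
      then have hb: "bij_betw h (verts H) (verts S)" unfolding isos_def by auto
      have "bij_betw (restrict (k \<circ> h) (verts H)) (verts H) (verts H)"
        using bij_betw_trans[OF hb kbij] by (simp cong: bij_betw_cong)
      moreover have "h x \<in> verts S" if "x \<in> verts H" for x using hb that by (auto simp: bij_betw_def)
      moreover have "{u, v} \<in> edges H \<longleftrightarrow> {k (h u), k (h v)} \<in> edges H"
        if "u \<in> verts H" "v \<in> verts H" for u v
        using h kiff[of "h u" "h v"] calculation(2) that unfolding isos_def by blast
      ultimately show "restrict (k \<circ> h) (verts H) \<in> isos H H"
        unfolding isos_def by simp
    qed
  qed
  then show ?thesis by (simp add: bij_betw_same_card)
qed

text \<open>The embeddings fall into disjoint classes, one for each copy, and each class is as large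
  as the automorphism group.\<close>

lemma card_embeddings:
  assumes H: "simple_graph H" and G: "simple_graph G"
  shows "card (embeddings H G) = card (isos H H) * num_copies H G"
proof -
  have "card (embeddings H G) = (\<Sum>S\<in>copies H G. card (isos H S))"
    unfolding embeddings_eq_UN_isos[OF assms]
  proof (rule card_UN_disjoint[OF finite_copies[OF G]])
    show "\<forall>S\<in>copies H G. finite (isos H S)"
      using finite_embeddings[OF assms] unfolding embeddings_eq_UN_isos[OF assms]
      by (auto intro: finite_subset)
    show "\<forall>S\<in>copies H G. \<forall>S'\<in>copies H G. S \<noteq> S' \<longrightarrow> isos H S \<inter> isos H S' = {}"
    proof (intro ballI impI equals0I)
      fix S S' f
      assume S: "S \<in> copies H G" "S' \<in> copies H G" "S \<noteq> S'" and f: "f \<in> isos H S \<inter> isos H S'"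
      have "simple_graph S" "simple_graph S'" using S unfolding copies_def is_subgraph_def by auto
      then show False using iso_image[OF H] f S(3) by (metis IntD1 IntD2)
    qed
  qed
  also have "\<dots> = (\<Sum>S\<in>copies H G. card (isos H H))"
    by (intro sum.cong refl card_isos) (simp add: copies_def)
  finally show ?thesis by (simp add: num_copies_def)
qed

lemma card_isos_self_pos:
  assumes H: "simple_graph H"
  shows "card (isos H H) > 0"
proof -
  have "H \<in> copies H H"
    unfolding copies_def is_subgraph_def graph_iso_def using H by (auto intro!: exI[of _ id])
  then have "isos H H \<subseteq> embeddings H H" using embeddings_eq_UN_isos[OF H H] by auto
  then have "finite (isos H H)" using finite_embeddings[OF H H] finite_subset by auto
  moreover have "restrict id (verts H) \<in> isos H H"
    unfolding isos_def using bij_betw_id by (simp add: id_def[symmetric] cong: bij_betw_cong)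
  ultimately show ?thesis by (auto simp: card_gt_0_iff)
qed

text \<open>Both counts carry the same positive factor, the number of automorphisms. This reduces
  both halves of the theorem to counting embeddings.\<close>

lemma num_copies_le_iff:
  assumes "simple_graph H" "simple_graph G" "simple_graph G'"
  shows "num_copies H G \<le> num_copies H G' \<longleftrightarrow> card (embeddings H G) \<le> card (embeddings H G')"
  using card_isos_self_pos[OF assms(1)] by (simp add: card_embeddings assms)

lemma no_complete_copy_imp_no_clique:
  assumes G: "simple_graph G" and none: "copies (complete_graph k) G = {}"
  shows "cliques (\<lambda>x y. {x, y} \<in> edges G) (verts G) k = {}"
proof (rule ccontr)
  assume "cliques (\<lambda>x y. {x, y} \<in> edges G) (verts G) k \<noteq> {}"
  then obtain R where R: "R \<subseteq> verts G" "card R = k" "pairwise (\<lambda>x y. {x, y} \<in> edges G) R"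
    unfolding cliques_def by auto
  have fin: "finite R" using R(1) G finite_subset unfolding simple_graph_def by auto
  define S where "S = (R, {e. e \<subseteq> R \<and> card e = 2})"
  have "edges S \<subseteq> edges G"
    using R(3) unfolding S_def pairwise_def by (auto simp: card_2_iff)
  then have "is_subgraph S G" using R fin unfolding is_subgraph_def simple_graph_def S_def by auto
  moreover have "graph_iso (complete_graph k) S"
  proof -
    obtain f where f: "bij_betw f {..<k} R"
      using ex_bij_betw_nat_finite[OF fin] R(2) by (auto simp: atLeast0LessThan)
    have "u \<noteq> v \<longleftrightarrow> f u \<noteq> f v" "f u \<in> R" if "u < k" "v < k" for u v
      using f that unfolding bij_betw_def inj_on_def by auto
    then have "{u, v} \<in> edges (complete_graph k) \<longleftrightarrow> {f u, f v} \<in> edges S"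
      if "u < k" "v < k" for u v
      using that unfolding complete_graph_def S_def by (auto simp: card_2_iff doubleton_eq_iff)
    then show ?thesis using f unfolding graph_iso_def
      by (auto simp: complete_graph_def S_def intro!: exI[of _ f])
  qed
  ultimately have "S \<in> copies (complete_graph k) G" unfolding copies_def by simp
  then show False using none by simp
qed

section \<open>Adjacency and part sizes in the Turan graph and in \<open>H_graph\<close>\<close>

lemma verts_turan_graph [simp]: "verts (turan_graph q n) = {..<n}"
  by (simp add: turan_graph_def complete_multipartite_def)

lemma edges_turan_graph_iff:
  "{u, v} \<in> edges (turan_graph q n) \<longleftrightarrow> u < n \<and> v < n \<and> u mod q \<noteq> v mod q"
  unfolding turan_graph_def complete_multipartite_def by (auto simp: doubleton_eq_iff)

lemma verts_H_graph [simp]: "verts (H_graph r s l) = {..<r - 1} \<times> {..<s}"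
  by (simp add: H_graph_def complete_multipartite_def Let_def)

lemma H_graph_edgeD: "{u, v} \<in> edges (H_graph r s l) \<Longrightarrow> fst u \<noteq> fst v"
  unfolding H_graph_def complete_multipartite_def Let_def by (auto simp: doubleton_eq_iff)

text \<open>The last hypothesis excludes every pair \<open>{(0, j), (1, j)}\<close>, not only those
  with \<open>j < l\<close>, so the edges obtained here are present for every
  \<open>l\<close>.\<close>

lemma H_graph_edgeI:
  assumes "i < r - 1" "i' < r - 1" "j < s" "j' < s" "i \<noteq> i'" "j \<noteq> j' \<or> i \<ge> 2 \<or> i' \<ge> 2"
  shows "{(i, j), (i', j')} \<in> edges (H_graph r s l)"
  using assms unfolding H_graph_def complete_multipartite_def Let_def
  by (fastforce simp: doubleton_eq_iff)

text \<open>A falling factorial. The subtraction is truncated, so the product vanishes when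
  \<open>A\<close> is larger than \<open>B\<close>.\<close>

lemma card_injections:
  assumes "finite A" "finite B"
  shows "card {f \<in> A \<rightarrow>\<^sub>E B. inj_on f A} = (\<Prod>j<card A. card B - j)"
  using card_inj_on_subset_funcset[OF assms, of A] by (simp add: atLeast0LessThan)

text \<open>The quotient is the ceiling of \<open>(n - i) / q\<close>, written without a negative
  term. Adding vertex \<open>n\<close> enlarges class \<open>i\<close> exactly when
  \<open>n mod q = i\<close>, and this is when the quotient steps up.\<close>

lemma card_turan_part:
  assumes "i < q"
  shows "card {v \<in> {..<n}. v mod q = i} = (n + (q - 1 - i)) div q"
proof (induction n)
  case (Suc n)
  have "{v \<in> {..<Suc n}. v mod q = i} = (if n mod q = i then insert n else id) {v \<in> {..<n}. v mod q = i}"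
    by (auto simp: less_Suc_eq)
  then have "card {v \<in> {..<Suc n}. v mod q = i} = (if n mod q = i then 1 else 0) + card {v \<in> {..<n}. v mod q = i}"
    by simp
  moreover have "(Suc n + (q - 1 - i)) div q = (if n mod q = i then 1 else 0) + (n + (q - 1 - i)) div q"
  proof -
    have "q dvd Suc (n + (q - 1 - i)) \<longleftrightarrow> n mod q = i"
    proof -
      have "Suc (n + (q - 1 - i)) = n + (q - i)" using assms by simp
      moreover have "q dvd n + (q - i) \<longleftrightarrow> n mod q = i"
      proof -
        have "(int n - int i) mod int q = 0 \<longleftrightarrow> n mod q = i"
          using assms by (metis mod_eq_dvd_iff mod_less of_nat_eq_iff of_nat_mod dvd_eq_mod_eq_0)
        moreover have "int (n + (q - i)) mod int q = (int n - int i) mod int q"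
          using assms by (simp add: of_nat_diff) (metis add.commute diff_add_eq mod_add_self2)
        ultimately show ?thesis by (metis dvd_eq_mod_eq_0 of_nat_dvd_iff)
      qed
      ultimately show ?thesis by (simp only:)
    qed
    then show ?thesis using assms by (simp add: div_Suc dvd_eq_mod_eq_0)
  qed
  ultimately show ?case using Suc.IH by simp
qed (use assms in simp)

section \<open>Clique factors\<close>

text \<open>Each permutation \<open>p\<close> of the residue classes, with an injection of part
  \<open>i\<close> into class \<open>p i\<close> for every \<open>i\<close>, yields an embedding,
  since different classes are completely joined. Different choices yield different
  embeddings.\<close>

lemma card_embeddings_turan_ge:
  assumes "s > 0"
  shows "fact q * (\<Prod>i<q. \<Prod>j<s. (n + (q - 1 - i)) div q - j)
    \<le> card (embeddings (H_graph (Suc q) s l) (turan_graph q n))"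
proof -
  define part where "part i = {v \<in> {..<n}. v mod q = i}" for i
  define J where "J i = {h \<in> {..<s} \<rightarrow>\<^sub>E part i. inj_on h {..<s}}" for i
  define S where "S = {p \<in> {..<q} \<rightarrow>\<^sub>E {..<q}. inj_on p {..<q}}"
  define D where "D = (SIGMA p:S. \<Pi>\<^sub>E i\<in>{..<q}. J (p i))"
  define \<Phi> where "\<Phi> = (\<lambda>(p :: nat \<Rightarrow> nat, h). \<lambda>x\<in>{..<q} \<times> {..<s}. h (fst x) (snd x) :: nat)"
  have fin_part: "finite (part i)" for i unfolding part_def by simp
  have cardJ: "card (J i) = (\<Prod>j<s. (n + (q - 1 - i)) div q - j)" if "i < q" for i
    using card_injections[of "{..<s}" "part i"] card_turan_part[OF that, of n] fin_part
    unfolding J_def part_def by simp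
  have finJ: "finite (J i)" for i unfolding J_def
    by (rule finite_subset[of _ "{..<s} \<rightarrow>\<^sub>E part i"]) (auto intro!: finite_PiE fin_part)
  have finS: "finite S" unfolding S_def
    by (rule finite_subset[of _ "{..<q} \<rightarrow>\<^sub>E {..<q}"]) (auto intro!: finite_PiE)
  have cardS: "card S = fact q"
    using card_injections[of "{..<q}" "{..<q}"] fact_prod_rev[of q, where 'a = nat]
    unfolding S_def by (simp add: atLeast0LessThan)
  have bij: "bij_betw p {..<q} {..<q}" if "p \<in> S" for p
  proof -
    have "inj_on p {..<q}" "p ` {..<q} \<subseteq> {..<q}" using that unfolding S_def by auto
    then show ?thesis unfolding bij_betw_def by (simp add: endo_inj_surj)
  qed
  have "card D = (\<Sum>p\<in>S. \<Prod>i<q. card (J (p i)))"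
    unfolding D_def using finS finJ by (subst card_SigmaI) (auto intro!: finite_PiE simp: card_PiE)
  also have "\<dots> = (\<Sum>p\<in>S. \<Prod>i<q. card (J i))"
    by (intro sum.cong refl prod.reindex_bij_betw bij)
  also have "\<dots> = fact q * (\<Prod>i<q. \<Prod>j<s. (n + (q - 1 - i)) div q - j)"
    by (simp add: cardS cardJ)
  finally have cardD: "card D = fact q * (\<Prod>i<q. \<Prod>j<s. (n + (q - 1 - i)) div q - j)" .
  have DD: "h i \<in> {..<s} \<rightarrow>\<^sub>E part (p i)" "inj_on (h i) {..<s}" if "(p, h) \<in> D" "i < q" for p h i
    using that unfolding D_def J_def by (auto simp: PiE_iff)
  have \<Phi>: "\<Phi> (p, h) (i, j) = h i j" if "i < q" "j < s" for p h i j
    using that unfolding \<Phi>_def by simp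
  have val: "\<Phi> (p, h) (i, j) < n" "\<Phi> (p, h) (i, j) mod q = p i"
    if "(p, h) \<in> D" "i < q" "j < s" for p h i j
    using DD(1)[OF that(1,2)] that(2,3) unfolding part_def by (auto simp: \<Phi> PiE_iff)
  have "inj_on \<Phi> D"
  proof (rule inj_onI)
    fix a b assume ab: "a \<in> D" "b \<in> D" "\<Phi> a = \<Phi> b"
    obtain p h p' h' where eq: "a = (p, h)" "b = (p', h')" by fastforce
    \<comment> \<open>The residue of the image of \<open>(i, 0)\<close> reveals \<open>p i\<close>;
      this vertex exists because \<open>s > 0\<close>.\<close>
    have "p i = p' i" if "i < q" for i
      using val(2)[of p h i 0] val(2)[of p' h' i 0] ab eq that assms by simp
    moreover have "p \<in> {..<q} \<rightarrow>\<^sub>E {..<q}" "p' \<in> {..<q} \<rightarrow>\<^sub>E {..<q}"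
      using ab eq unfolding D_def S_def by auto
    ultimately have p: "p = p'" by (intro PiE_ext) auto
    have "h i = h' i" if i: "i < q" for i
    proof (rule PiE_ext)
      show "h i \<in> {..<s} \<rightarrow>\<^sub>E part (p i)" "h' i \<in> {..<s} \<rightarrow>\<^sub>E part (p i)"
        using DD(1) ab eq i p by auto
      show "h i j = h' i j" if "j \<in> {..<s}" for j
        using \<Phi>[of i j p h] \<Phi>[of i j p' h'] ab eq i that by simp
    qed
    moreover have "h \<in> (\<Pi>\<^sub>E i\<in>{..<q}. J (p i))" "h' \<in> (\<Pi>\<^sub>E i\<in>{..<q}. J (p i))"
      using ab eq p unfolding D_def by auto
    ultimately have "h = h'" by (intro PiE_ext) auto
    then show "a = b" using p eq by simp
  qed
  moreover have "\<Phi> ` D \<subseteq> embeddings (H_graph (Suc q) s l) (turan_graph q n)"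
  proof (intro image_subsetI)
    fix a assume a: "a \<in> D"
    obtain p h where eq: "a = (p, h)" by fastforce
    have pin: "p \<in> S" using a eq unfolding D_def by auto
    have pinj: "p i \<noteq> p i'" if "i < q" "i' < q" "i \<noteq> i'" for i i'
      using bij[OF pin] that unfolding bij_betw_def inj_on_def by auto
    have "\<Phi> a \<in> {..<q} \<times> {..<s} \<rightarrow>\<^sub>E {..<n}"
    proof (rule PiE_I)
      show "\<Phi> a x \<in> {..<n}" if "x \<in> {..<q} \<times> {..<s}" for x
        using that val(1) a eq by auto
      show "\<Phi> a x = undefined" if "x \<notin> {..<q} \<times> {..<s}" for x
        using that eq unfolding \<Phi>_def by simp
    qed
    moreover have "inj_on (\<Phi> a) ({..<q} \<times> {..<s})"
    proof (rule inj_onI)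
      fix x y assume xy: "x \<in> {..<q} \<times> {..<s}" "y \<in> {..<q} \<times> {..<s}" "\<Phi> a x = \<Phi> a y"
      obtain i j i' j' where ij: "x = (i, j)" "y = (i', j')" by fastforce
      have "p i = p i'" using val(2)[of p h i j] val(2)[of p h i' j'] a xy ij eq by auto
      then have "i = i'" using pinj xy ij by auto
      then show "x = y"
        using xy ij \<Phi>[of i j p h] \<Phi>[of i j' p h] inj_onD[OF DD(2)[of p h i]] a eq by auto
    qed
    moreover have "{\<Phi> a u, \<Phi> a v} \<in> edges (turan_graph q n)"
      if uv: "u \<in> {..<q} \<times> {..<s}" "v \<in> {..<q} \<times> {..<s}" "{u, v} \<in> edges (H_graph (Suc q) s l)" for u v
    proof -
      obtain i j i' j' where ij: "u = (i, j)" "v = (i', j')" by fastforce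
      then have "i \<noteq> i'" using H_graph_edgeD[OF uv(3)] by simp
      then show ?thesis
        using val[of p h i j] val[of p h i' j'] a eq ij uv(1,2) pinj[of i i']
        by (auto simp: edges_turan_graph_iff)
    qed
    ultimately show "\<Phi> a \<in> embeddings (H_graph (Suc q) s l) (turan_graph q n)"
      unfolding embeddings_def by simp
  qed
  ultimately have "card D \<le> card (embeddings (H_graph (Suc q) s l) (turan_graph q n))"
    by (rule card_inj_on_le)
      (rule finite_embeddings[OF simple_graph_H_graph simple_graph_turan_graph])
  then show ?thesis unfolding cardD .
qed

text \<open>A \<open>q\<close>-clique of the Turan graph takes one vertex from each residue class,
  so Zykov's bound becomes a product of class sizes.\<close>

lemma card_cliques_le_prod:
  assumes "finite V" "symp E" "cliques E V (Suc q) = {}" "q > 0"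
  shows "card (cliques E V q) \<le> (\<Prod>i<q. (card V + (q - 1 - i)) div q)"
proof -
  define n where "n = card V"
  define part where "part i = {v \<in> {..<n}. v mod q = i}" for i
  define T :: "nat \<Rightarrow> nat \<Rightarrow> bool" where "T = (\<lambda>x y. x mod q \<noteq> y mod q)"
  define P where "P = (\<Pi>\<^sub>E i\<in>{..<q}. part i)"
  have "cliques T {..<n} q \<subseteq> (\<lambda>f. f ` {..<q}) ` P"
  proof
    fix R assume "R \<in> cliques T {..<n} q"
    then have R: "R \<subseteq> {..<n}" "card R = q" "pairwise T R" unfolding cliques_def by auto
    have fR: "finite R" using R(1) finite_subset by blast
    have inj: "inj_on (\<lambda>x. x mod q) R" using R(3) unfolding pairwise_def T_def inj_on_def by blast
    have "(\<lambda>x. x mod q) ` R = {..<q}"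
      using assms(4) R(2) card_image[OF inj] by (intro card_subset_eq) auto
    then have bij: "bij_betw (\<lambda>x. x mod q) R {..<q}" using inj unfolding bij_betw_def by simp
    define f where "f = restrict (inv_into R (\<lambda>x. x mod q)) {..<q}"
    have fbij: "bij_betw (inv_into R (\<lambda>x. x mod q)) {..<q} R" using bij by (rule bij_betw_inv_into)
    then have "f ` {..<q} = R" unfolding f_def bij_betw_def by simp
    moreover have "f \<in> P"
      unfolding P_def
    proof (rule PiE_I)
      fix i assume i: "i \<in> {..<q}"
      then have "f i \<in> R" using fbij unfolding f_def by (auto simp: bij_betwE)
      moreover have "f i mod q = i" using bij_betw_inv_into_right[OF bij i] i unfolding f_def by simp
      ultimately show "f i \<in> part i" using R(1) unfolding part_def by auto
    qed (simp add: f_def)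
    ultimately show "R \<in> (\<lambda>f. f ` {..<q}) ` P" by blast
  qed
  moreover have "finite P" unfolding P_def part_def by (intro finite_PiE) auto
  ultimately have "card (cliques T {..<n} q) \<le> card P" using surj_card_le by blast
  also have "\<dots> = (\<Prod>i<q. (n + (q - 1 - i)) div q)"
    unfolding P_def part_def by (simp only: card_PiE finite_lessThan) (intro prod.cong refl card_turan_part, simp)
  finally show ?thesis using card_cliques_le_turan[OF assms, of q] unfolding T_def n_def by simp
qed

text \<open>Lists are used because the entry at position \<open>j\<close> has to record the image of
  the \<open>j\<close>-th clique of the factor.\<close>

definition clique_tuples :: "('a \<Rightarrow> 'a \<Rightarrow> bool) \<Rightarrow> 'a set \<Rightarrow> nat \<Rightarrow> nat \<Rightarrow> 'a set list set" where
  "clique_tuples E V q s = {L. length L = s \<and> set L \<subseteq> cliques E V q \<and> sorted_wrt disjnt L}"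

lemma finite_clique_tuples: "finite V \<Longrightarrow> finite (clique_tuples E V q s)"
  using finite_lists_length_eq[OF finite_cliques, of V E q s]
  by (rule finite_subset[rotated]) (auto simp: clique_tuples_def)

text \<open>Choose the first clique, then continue among the vertices outside it: \<open>q\<close>
  vertices fewer, and still no clique with \<open>q + 1\<close> vertices. The factor for
  \<open>j\<close> bounds the choices after \<open>j\<close> removals.\<close>

lemma card_clique_tuples_le:
  assumes "finite V" "symp E" "cliques E V (Suc q) = {}" "q > 0"
  shows "card (clique_tuples E V q s) \<le> (\<Prod>j<s. \<Prod>i<q. (card V - q * j + (q - 1 - i)) div q)"
  using assms
proof (induction s arbitrary: V)
  case 0
  have "clique_tuples E V q 0 = {[]}" unfolding clique_tuples_def by auto
  then show ?case by simp
next
  case (Suc s)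
  define n where "n = card V"
  define b where "b = (\<Prod>j<s. \<Prod>i<q. (n - q * Suc j + (q - 1 - i)) div q)"
  have "clique_tuples E V q (Suc s) \<subseteq> (\<Union>Q\<in>cliques E V q. (#) Q ` clique_tuples E (V - Q) q s)"
  proof
    fix L assume L: "L \<in> clique_tuples E V q (Suc s)"
    then obtain Q M where QM: "L = Q # M" unfolding clique_tuples_def by (cases L) auto
    have "Q \<in> cliques E V q" using L QM unfolding clique_tuples_def by simp
    moreover have "set M \<subseteq> cliques E (V - Q) q"
      using L QM unfolding clique_tuples_def cliques_def by (auto simp: disjnt_def)
    then have "M \<in> clique_tuples E (V - Q) q s" using L QM unfolding clique_tuples_def by simp
    ultimately show "L \<in> (\<Union>Q\<in>cliques E V q. (#) Q ` clique_tuples E (V - Q) q s)"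
      using QM by blast
  qed
  then have "card (clique_tuples E V q (Suc s))
      \<le> card (\<Union>Q\<in>cliques E V q. (#) Q ` clique_tuples E (V - Q) q s)"
    using Suc.prems by (intro card_mono) (auto intro!: finite_cliques finite_clique_tuples)
  also have "\<dots> \<le> (\<Sum>Q\<in>cliques E V q. card ((#) Q ` clique_tuples E (V - Q) q s))"
    by (intro card_UN_le finite_cliques Suc.prems)
  also have "\<dots> \<le> (\<Sum>Q\<in>cliques E V q. b)"
  proof (rule sum_mono)
    fix Q assume "Q \<in> cliques E V q"
    then have Q: "Q \<subseteq> V" "card Q = q" unfolding cliques_def by auto
    have "card (V - Q) = n - q"
      using Q Suc.prems(1) finite_subset unfolding n_def by (metis card_Diff_subset)
    moreover have "cliques E (V - Q) (Suc q) = {}"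
      using Suc.prems(3) cliques_mono[of "V - Q" V E E] by auto
    moreover have "n - q - q * j = n - q * Suc j" for j by simp
    ultimately have "card (clique_tuples E (V - Q) q s) \<le> b"
      using Suc.IH[of "V - Q"] Suc.prems unfolding b_def by simp
    then show "card ((#) Q ` clique_tuples E (V - Q) q s) \<le> b"
      by (simp add: card_image)
  qed
  also have "\<dots> = card (cliques E V q) * b" by simp
  also have "\<dots> \<le> (\<Prod>i<q. (n + (q - 1 - i)) div q) * b"
    using card_cliques_le_prod[OF Suc.prems] unfolding n_def by (rule mult_right_mono) simp
  also have "\<dots> = (\<Prod>j<Suc s. \<Prod>i<q. (n - q * j + (q - 1 - i)) div q)"
    unfolding b_def prod.lessThan_Suc_shift by simp
  finally show ?case unfolding n_def .
qed

text \<open>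
  For fixed \<open>j\<close> the vertices \<open>cell s j k\<close> with \<open>k < q\<close> form a clique of \<open>H_graph (Suc q) s l\<close>. The
  cyclic shift in part 0 avoids the deleted edges, whatever \<open>l\<close> is.
\<close>

definition cell :: "nat \<Rightarrow> nat \<Rightarrow> nat \<Rightarrow> nat \<times> nat" where
  "cell s j k = (k, if k = 0 then Suc j mod s else j)"

lemma Suc_mod_inj:
  assumes "j < s" "j' < s" "Suc j mod s = Suc j' mod s"
  shows "j = j'"
  using assms by (cases "Suc j = s"; cases "Suc j' = s") auto

lemma cell_inj: "j < s \<Longrightarrow> j' < s \<Longrightarrow> cell s j k = cell s j' k' \<Longrightarrow> j = j' \<and> k = k'"
  unfolding cell_def using Suc_mod_inj by (auto split: if_splits)

lemma cell_surj:
  assumes "y < s"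
  obtains j where "j < s" "cell s j k = (k, y)"
proof (cases "k = 0")
  case True
  show ?thesis
  proof (cases y)
    case 0
    \<comment> \<open>The cyclic shift wraps around here.\<close>
    then show ?thesis using that[of "s - 1"] True assms by (simp add: cell_def)
  next
    case (Suc z)
    then show ?thesis using that[of z] True assms by (simp add: cell_def)
  qed
next
  case False
  then show ?thesis using that[of y] assms by (simp add: cell_def)
qed

text \<open>A missing edge could only join parts 0 and 1 at equal second coordinates, which the
  conditions on \<open>Suc i mod s\<close> and \<open>Suc j mod s\<close> rule out. With
  \<open>i = j\<close> and \<open>s >= 2\<close> this shows that the cells of one index form a
  clique.\<close>

lemma cell_adjacent:
  assumes "i < s" "j < s" "Suc i mod s \<noteq> j" "Suc j mod s \<noteq> i" "m < q" "k < q" "m \<noteq> k"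
  shows "{cell s i m, cell s j k} \<in> edges (H_graph (Suc q) s l)"
proof -
  have "Suc i mod s < s" "Suc j mod s < s" using assms by auto
  then show ?thesis
    unfolding cell_def using assms by (intro H_graph_edgeI) (auto split: if_splits)
qed

text \<open>
  If \<open>f\<close> and \<open>g\<close> differed on the \<open>j\<close>-th clique, a vertex of its image would be adjacent to the
  whole image of the \<open>i\<close>-th clique, giving a clique with \<open>q + 1\<close> vertices.
\<close>

lemma embedding_determined:
  assumes G: "simple_graph G" and free: "cliques (\<lambda>x y. {x, y} \<in> edges G) (verts G) (Suc q) = {}"
    and f: "f \<in> embeddings (H_graph (Suc q) s l) G" and g: "g \<in> embeddings (H_graph (Suc q) s l) G"
    and ij: "i < s" "j < s" "Suc i mod s \<noteq> j" "Suc j mod s \<noteq> i"  and s: "s \<ge> 2"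
    and agree: "\<And>k. k < q \<Longrightarrow> f (cell s i k) = g (cell s i k)"
    and img: "(\<lambda>k. f (cell s j k)) ` {..<q} = (\<lambda>k. g (cell s j k)) ` {..<q}"
    and k: "k < q"
  shows "f (cell s j k) = g (cell s j k)"
proof -
  have cellV: "cell s i k \<in> {..<q} \<times> {..<s}" if "i < s" "k < q" for i k
    using that by (auto simp: cell_def)
  have hom: "{h u, h v} \<in> edges G"
    if "h \<in> embeddings (H_graph (Suc q) s l) G" "u \<in> {..<q} \<times> {..<s}" "v \<in> {..<q} \<times> {..<s}"
      "{u, v} \<in> edges (H_graph (Suc q) s l)" for h u v
    using embeddings_edge[OF that(1,4)] that(2,3) by simp
  have fV: "f u \<in> verts G" if "u \<in> {..<q} \<times> {..<s}" for u
    using f that unfolding embeddings_def by (auto simp: PiE_iff)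
  have inj: "inj_on f ({..<q} \<times> {..<s})" using f unfolding embeddings_def by simp
  define v where "v = f (cell s j k)"
  have "v \<in> (\<lambda>k. g (cell s j k)) ` {..<q}" using img k unfolding v_def by auto
  then obtain k' where k': "k' < q" "v = g (cell s j k')" by auto
  show ?thesis
  proof (cases "k = k'")
    case True
    then show ?thesis using k' v_def by simp
  next
    case False
    define Q where "Q = (\<lambda>m. f (cell s i m)) ` {..<q}"
    have adj: "{v, f (cell s i m)} \<in> edges G" if m: "m < q" for m
    proof (cases "m = k")
      case True
      \<comment> \<open>Under \<open>f\<close> both vertices come from part \<open>k\<close>, so
        \<open>f\<close> provides no edge. But \<open>v\<close> is also the image under
        \<open>g\<close> of a cell in part \<open>k'\<close>, and \<open>g\<close> agrees with
        \<open>f\<close> on the \<open>i\<close>-th clique.\<close>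
      have "{g (cell s j k'), g (cell s i k)} \<in> edges G"
        by (rule hom[OF g]) (use ij k k' False cellV cell_adjacent in auto)
      then show ?thesis using True k' agree[OF k] by simp
    next
      case neq: False
      show ?thesis unfolding v_def
        by (rule hom[OF f]) (use ij k m neq cellV cell_adjacent in auto)
    qed
    have "x \<noteq> y" if "{x, y} \<in> edges G" for x y using G that unfolding simple_graph_def by fastforce
    then have "v \<notin> Q" using adj unfolding Q_def by blast
    moreover have "inj_on (\<lambda>m. f (cell s i m)) {..<q}"
      using inj cellV[OF ij(1)] cell_inj[OF ij(1) ij(1)] unfolding inj_on_def by (metis lessThan_iff)
    then have "card Q = q" unfolding Q_def by (simp add: card_image)
    ultimately have "card (insert v Q) = Suc q" unfolding Q_def by simp
    moreover have "insert v Q \<subseteq> verts G" unfolding Q_def v_def using fV[OF cellV] ij k by blast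
    moreover have "pairwise (\<lambda>x y. {x, y} \<in> edges G) (insert v Q)"
    proof -
      have "Suc i mod s \<noteq> i" using s ij(1) by (cases "Suc i = s") auto
      then have "{f (cell s i m), f (cell s i m')} \<in> edges G" if "m < q" "m' < q" "m \<noteq> m'" for m m'
        by (intro hom[OF f]) (use ij that cellV cell_adjacent in auto)
      then have "pairwise (\<lambda>x y. {x, y} \<in> edges G) Q" unfolding Q_def pairwise_def by auto
      then show ?thesis using adj unfolding pairwise_insert Q_def by (auto simp: insert_commute)
    qed
    ultimately show ?thesis using free unfolding cliques_def by auto
  qed
qed

text \<open>Agreement of two embeddings spreads from clique 0 to every clique through pairs of
  indices that are not cyclically consecutive. This reaches all indices because the complement of a
  cycle of length \<open>s >= 5\<close> is connected.\<close>

lemma card_embeddings_le: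
  assumes G: "simple_graph G" and free: "cliques (\<lambda>x y. {x, y} \<in> edges G) (verts G) (Suc q) = {}"
    and s: "s \<ge> 5" and q: "q > 0"
  shows "card (embeddings (H_graph (Suc q) s l) G)
    \<le> fact q * card (clique_tuples (\<lambda>x y. {x, y} \<in> edges G) (verts G) q s)"
proof -
  define E where "E = (\<lambda>x y. {x, y} \<in> edges G)"
  define H where "H = H_graph (Suc q) s l"
  define L where "L f = map (\<lambda>j. (\<lambda>k. f (cell s j k)) ` {..<q}) [0..<s]" for f :: "nat \<times> nat \<Rightarrow> 'a"
  define \<Phi> where "\<Phi> f = (L f, \<lambda>k\<in>{..<q}. f (cell s 0 k))" for f :: "nat \<times> nat \<Rightarrow> 'a"
  \<comment> \<open>\<open>hd M\<close> stands for the image of clique 0; it has \<open>q\<close>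
    elements, so there are \<open>q!\<close> ways to label it.\<close>
  define D where "D = (SIGMA M:clique_tuples E (verts G) q s. {h \<in> {..<q} \<rightarrow>\<^sub>E hd M. inj_on h {..<q}})"
  have finV: "finite (verts G)" using G unfolding simple_graph_def by simp
  have fint: "finite (clique_tuples E (verts G) q s)" using finV by (rule finite_clique_tuples)
  have hd: "hd M \<subseteq> verts G" "card (hd M) = q" if "M \<in> clique_tuples E (verts G) q s" for M
    using that s unfolding clique_tuples_def cliques_def by (cases M; auto)+
  have fin: "finite (hd M)" if "M \<in> clique_tuples E (verts G) q s" for M
    using hd(1)[OF that] finV finite_subset by blast
  have fin': "finite {h \<in> {..<q} \<rightarrow>\<^sub>E hd M. inj_on h {..<q}}" if "M \<in> clique_tuples E (verts G) q s" for M
    by (rule finite_subset[of _ "{..<q} \<rightarrow>\<^sub>E hd M"]) (auto intro!: finite_PiE fin[OF that])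
  have "card {h \<in> {..<q} \<rightarrow>\<^sub>E hd M. inj_on h {..<q}} = fact q" if "M \<in> clique_tuples E (verts G) q s" for M
    using card_injections[of "{..<q}" "hd M"] fin[OF that] hd(2)[OF that] fact_prod_rev[of q, where 'a = nat]
    by (simp add: atLeast0LessThan)
  then have "card D = fact q * card (clique_tuples E (verts G) q s)"
    unfolding D_def using fint fin' by (subst card_SigmaI) auto
  moreover have "finite D" unfolding D_def using fint fin' by (intro finite_SigmaI) auto
  moreover have cellV: "cell s i k \<in> {..<q} \<times> {..<s}" if "i < s" "k < q" for i k
    using that by (auto simp: cell_def)
  have "inj_on \<Phi> (embeddings H G)"
  proof (rule inj_onI)
    fix f g assume fg: "f \<in> embeddings H G" "g \<in> embeddings H G" "\<Phi> f = \<Phi> g"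
    have img: "(\<lambda>k. f (cell s j k)) ` {..<q} = (\<lambda>k. g (cell s j k)) ` {..<q}" if "j < s" for j
    proof -
      have "L f ! j = L g ! j" using fg(3) unfolding \<Phi>_def by simp
      then show ?thesis using that unfolding L_def by simp
    qed
    have step: "\<forall>k<q. f (cell s j k) = g (cell s j k)"
      if "\<forall>k<q. f (cell s i k) = g (cell s i k)" "i < s" "j < s" "Suc i mod s \<noteq> j" "Suc j mod s \<noteq> i" for i j
      using embedding_determined[OF G free fg(1,2)[unfolded H_def] that(2-5)] that(1) img that(3) s by auto
    have 0: "\<forall>k<q. f (cell s 0 k) = g (cell s 0 k)"
    proof (intro allI impI)
      fix k assume "k < q"
      moreover have "(\<lambda>k\<in>{..<q}. f (cell s 0 k)) k = (\<lambda>k\<in>{..<q}. g (cell s 0 k)) k"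
        using fg(3) unfolding \<Phi>_def by simp
      ultimately show "f (cell s 0 k) = g (cell s 0 k)" by simp
    qed
    have mid: "\<forall>k<q. f (cell s j k) = g (cell s j k)" if "1 < j" "j < s - 1" for j
      by (rule step[OF 0]) (use that s in auto)
    \<comment> \<open>The neighbours 1 and \<open>s - 1\<close> of 0 on the cycle are reached in two
      moves, through 3 and through 2. Index 3 differs from \<open>s - 1\<close> because
      \<open>s >= 5\<close>.\<close>
    have 1: "\<forall>k<q. f (cell s 1 k) = g (cell s 1 k)"
      by (rule step[OF mid[of 3]]) (use s in auto)
    have last: "\<forall>k<q. f (cell s (s - 1) k) = g (cell s (s - 1) k)"
      by (rule step[OF mid[of 2]]) (use s in auto)
    have all: "\<forall>k<q. f (cell s j k) = g (cell s j k)" if "j < s" for j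
    proof -
      have "j = 0 \<or> j = 1 \<or> j = s - 1 \<or> 1 < j \<and> j < s - 1" using that by linarith
      then show ?thesis using 0 1 last mid by blast
    qed
    show "f = g"
    proof (rule PiE_ext)
      show "f \<in> {..<q} \<times> {..<s} \<rightarrow>\<^sub>E verts G" "g \<in> {..<q} \<times> {..<s} \<rightarrow>\<^sub>E verts G"
        using fg unfolding embeddings_def H_def by auto
      fix x assume x: "x \<in> {..<q} \<times> {..<s}"
      then obtain k y where ky: "x = (k, y)" "k < q" "y < s" by auto
      obtain j where "j < s" "cell s j k = (k, y)" using cell_surj[OF ky(3)] by blast
      then show "f x = g x" using all ky by metis
    qed
  qed
  moreover have "\<Phi> ` embeddings H G \<subseteq> D"
  proof (intro image_subsetI)
    fix f assume f: "f \<in> embeddings H G"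
    then have fV: "f u \<in> verts G" if "u \<in> {..<q} \<times> {..<s}" for u
      using that unfolding embeddings_def H_def by (auto simp: PiE_iff)
    have inj: "inj_on f ({..<q} \<times> {..<s})" using f unfolding embeddings_def H_def by simp
    have hom: "{f u, f v} \<in> edges G"
      if "u \<in> {..<q} \<times> {..<s}" "v \<in> {..<q} \<times> {..<s}" "{u, v} \<in> edges H" for u v
      using embeddings_edge[OF f that(3)] that(1,2) unfolding H_def by simp
    define B where "B j = (\<lambda>k. f (cell s j k)) ` {..<q}" for j
    have finj: "j = j' \<and> k = k'" if "f (cell s j k) = f (cell s j' k')" "j < s" "j' < s" "k < q" "k' < q" for j j' k k'
      using that cell_inj inj_onD[OF inj that(1)] cellV by metis
    have Bc: "B j \<in> cliques E (verts G) q" if j: "j < s" for j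
    proof -
      have nj: "Suc j mod s \<noteq> j" using s j by (cases "Suc j = s") auto
      have "inj_on (\<lambda>k. f (cell s j k)) {..<q}" using finj j unfolding inj_on_def by blast
      then have "card (B j) = q" unfolding B_def by (simp add: card_image)
      moreover have "B j \<subseteq> verts G" unfolding B_def using fV[OF cellV] j by blast
      moreover have "{f (cell s j m), f (cell s j m')} \<in> edges G" if "m < q" "m' < q" "m \<noteq> m'" for m m'
        by (intro hom cellV) (use j that nj cell_adjacent in \<open>auto simp: H_def\<close>)
      then have "pairwise E (B j)" unfolding B_def pairwise_def E_def by auto
      ultimately show ?thesis unfolding cliques_def by simp
    qed
    have disj: "disjnt (B j) (B j')" if "j < s" "j' < s" "j \<noteq> j'" for j j'
      using finj that unfolding B_def disjnt_def by blast
    have Lf: "L f = map B [0..<s]" unfolding L_def B_def by simp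
    have "L f \<in> clique_tuples E (verts G) q s"
      unfolding clique_tuples_def Lf using Bc disj by (auto simp: sorted_wrt_iff_nth_less)
    moreover have "hd (L f) = B 0" unfolding Lf using s by (simp add: hd_map)
    moreover have "(\<lambda>k\<in>{..<q}. f (cell s 0 k)) \<in> {..<q} \<rightarrow>\<^sub>E B 0" unfolding B_def by auto
    moreover have "inj_on (\<lambda>k\<in>{..<q}. f (cell s 0 k)) {..<q}"
      using finj s unfolding inj_on_def by auto
    ultimately show "\<Phi> f \<in> D" unfolding D_def \<Phi>_def by simp
  qed
  ultimately show ?thesis using card_inj_on_le[of \<Phi> "embeddings H G" D] unfolding E_def H_def by simp
qed

text \<open>The upper bound from clique tuples and the lower bound from class-wise injections are
  the same product with its two indices exchanged. The inequality is obtained for every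
  \<open>n\<close>, not only for large ones.\<close>

lemma turan_good_H_graph:
  assumes q: "q > 0" and s: "s \<ge> 5"
  shows "turan_good q (H_graph (Suc q) s l)"
  unfolding turan_good_def
proof (intro always_eventually allI impI)
  fix n and G :: "nat ugraph"
  assume "simple_graph G \<and> card (verts G) = n \<and> copies (complete_graph (q + 1)) G = {}"
  then have G: "simple_graph G" and n: "card (verts G) = n" and "copies (complete_graph (Suc q)) G = {}"
    by auto
  then have free: "cliques (\<lambda>x y. {x, y} \<in> edges G) (verts G) (Suc q) = {}"
    by (intro no_complete_copy_imp_no_clique)
  define H where "H = H_graph (Suc q) s l"
  have fin: "finite (verts G)" using G unfolding simple_graph_def by simp
  have sym: "symp (\<lambda>x y. {x, y} \<in> edges G)" unfolding symp_def by (simp add: insert_commute)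
  \<comment> \<open>Removing \<open>j\<close> cliques from the Turan graph takes \<open>j\<close>
    vertices from every class. If \<open>q * j > n\<close>, truncation makes both sides 0.\<close>
  have shift: "(n - q * j + (q - 1 - i)) div q = (n + (q - 1 - i)) div q - j" if "i < q" for i j
  proof (cases "q * j \<le> n")
    case True
    then have "n + (q - 1 - i) = (n - q * j + (q - 1 - i)) + q * j" by simp
    then have "(n + (q - 1 - i)) div q = (n - q * j + (q - 1 - i)) div q + j"
      using q by (metis div_mult_self2 add.commute less_numeral_extra(3))
    then show ?thesis by simp
  next
    case False
    then have "n + (q - 1 - i) < q * j + q" by simp
    then have "(n + (q - 1 - i)) div q < Suc j"
      using q by (simp add: div_less_iff_less_mult algebra_simps)
    then show ?thesis using False that by simp
  qed
  have "card (embeddings H G) \<le> fact q * card (clique_tuples (\<lambda>x y. {x, y} \<in> edges G) (verts G) q s)"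
    unfolding H_def by (rule card_embeddings_le[OF G free s q])
  also have "\<dots> \<le> fact q * (\<Prod>j<s. \<Prod>i<q. (n - q * j + (q - 1 - i)) div q)"
    using card_clique_tuples_le[OF fin sym free q, of s] unfolding n by simp
  also have "\<dots> = fact q * (\<Prod>i<q. \<Prod>j<s. (n + (q - 1 - i)) div q - j)"
    by (subst prod.swap, intro arg_cong2[where f = "(*)"] prod.cong refl shift) simp
  also have "\<dots> \<le> card (embeddings H (turan_graph q n))"
    unfolding H_def using s by (intro card_embeddings_turan_ge) simp
  finally show "num_copies H G \<le> num_copies H (turan_graph q n)"
    using num_copies_le_iff simple_graph_H_graph simple_graph_turan_graph G H_def by metis
qed

section \<open>Colourings\<close>

definition colourings :: "nat \<Rightarrow> 'a ugraph \<Rightarrow> ('a \<Rightarrow> nat) set" where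
  "colourings k H = {c \<in> verts H \<rightarrow>\<^sub>E {..<k}.
     \<forall>u\<in>verts H. \<forall>v\<in>verts H. {u, v} \<in> edges H \<longrightarrow> c u \<noteq> c v}"

lemma finite_colourings: "finite (verts H) \<Longrightarrow> finite (colourings k H)"
  by (rule finite_subset[of _ "verts H \<rightarrow>\<^sub>E {..<k}"]) (auto simp: colourings_def intro!: finite_PiE)

text \<open>A vertex of this Turan graph is a class \<open>x mod k\<close> together with a position
  \<open>x div k < M\<close>. The classes of an embedding form a proper colouring; the positions are
  bounded as if they were arbitrary.\<close>

lemma card_embeddings_turan_le:
  assumes H: "simple_graph H" and k: "k > 0"
  shows "card (embeddings H (turan_graph k (k * M))) \<le> card (colourings k H) * M ^ card (verts H)"
proof -
  have fin: "finite (verts H)" using H unfolding simple_graph_def by simp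
  define \<Phi> where "\<Phi> f = (restrict (\<lambda>x. f x mod k) (verts H), restrict (\<lambda>x. f x div k) (verts H))"
    for f :: "'a \<Rightarrow> nat"
  define D where "D = colourings k H \<times> (verts H \<rightarrow>\<^sub>E {..<M})"
  have "inj_on \<Phi> (embeddings H (turan_graph k (k * M)))"
  proof (rule inj_onI)
    fix f g assume f: "f \<in> embeddings H (turan_graph k (k * M))"
      and g: "g \<in> embeddings H (turan_graph k (k * M))" and eq: "\<Phi> f = \<Phi> g"
    show "f = g"
    proof (rule PiE_ext)
      show "f \<in> verts H \<rightarrow>\<^sub>E {..<k * M}" "g \<in> verts H \<rightarrow>\<^sub>E {..<k * M}"
        using f g unfolding embeddings_def by auto
      fix x assume x: "x \<in> verts H"
      have "restrict (\<lambda>x. f x mod k) (verts H) x = restrict (\<lambda>x. g x mod k) (verts H) x"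
        "restrict (\<lambda>x. f x div k) (verts H) x = restrict (\<lambda>x. g x div k) (verts H) x"
        using eq unfolding \<Phi>_def by auto
      then have "f x mod k = g x mod k" "f x div k = g x div k" using x by auto
      then show "f x = g x" by (metis div_mult_mod_eq)
    qed
  qed
  moreover have "\<Phi> ` embeddings H (turan_graph k (k * M)) \<subseteq> D"
  proof (intro image_subsetI)
    fix f assume f: "f \<in> embeddings H (turan_graph k (k * M))"
    have "f x < k * M" if "x \<in> verts H" for x
      using f that unfolding embeddings_def by (auto simp: PiE_iff)
    then have "f x div k < M" if "x \<in> verts H" for x
      using that by (simp add: less_mult_imp_div_less mult.commute)
    then have "restrict (\<lambda>x. f x div k) (verts H) \<in> verts H \<rightarrow>\<^sub>E {..<M}" by auto
    moreover have "f u mod k \<noteq> f v mod k" if "u \<in> verts H" "v \<in> verts H" "{u, v} \<in> edges H" for u v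
      using embeddings_edge[OF f that(3,1,2)] unfolding edges_turan_graph_iff by simp
    then have "restrict (\<lambda>x. f x mod k) (verts H) \<in> colourings k H"
      unfolding colourings_def using k by simp
    ultimately show "\<Phi> f \<in> D" unfolding D_def \<Phi>_def by simp
  qed
  moreover have "finite D" unfolding D_def using fin by (auto intro!: finite_colourings finite_PiE)
  ultimately have "card (embeddings H (turan_graph k (k * M))) \<le> card D" by (rule card_inj_on_le)
  also have "\<dots> = card (colourings k H) * M ^ card (verts H)"
    unfolding D_def using fin by (simp add: card_cartesian_product card_funcsetE)
  finally show ?thesis .
qed

text \<open>A vertex in a part \<open>i >= 2\<close> is joined to all other parts, so its colour is
  private. If one of the first two parts had no private colour, its \<open>s\<close> colours would
  be distinct and, with one colour for each part from 2 on, would make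
  \<open>s + (q - 2) > q + 1\<close> colours.\<close>

lemma colouring_private_colour:
  assumes c: "c \<in> colourings (Suc q) (H_graph (Suc q) s l)" and s: "s \<ge> 4" and i: "i < q"
  shows "\<exists>x<s. \<forall>i'<q. \<forall>y<s. i' \<noteq> i \<longrightarrow> c (i', y) \<noteq> c (i, x)"
proof -
  have ne: "c (a, x) \<noteq> c (b, y)" if "a < q" "b < q" "x < s" "y < s" "a \<noteq> b" "x \<noteq> y \<or> a \<ge> 2 \<or> b \<ge> 2" for a b x y
    using c H_graph_edgeI[of a "Suc q" b x s y l] that unfolding colourings_def by auto
  show ?thesis
  proof (cases "i \<ge> 2")
    case True
    then show ?thesis using ne[of _ i _ 0] i s by (intro exI[of _ 0]) auto
  next
    case False
    define k where "k = 1 - i"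
    have "k \<noteq> i" using False unfolding k_def by (cases i) auto
    have k: "k \<noteq> i" "k < 2" "i < 2" using False \<open>k \<noteq> i\<close> unfolding k_def by auto
    have k_cases: "b = i \<or> b = k \<or> b \<ge> 2" for b using False unfolding k_def by linarith
    show ?thesis
    proof (rule ccontr)
      assume neg: "\<not> ?thesis"
      \<comment> \<open>The colour of \<open>(i, x)\<close> can recur outside part \<open>i\<close>
        only at a non-neighbour, that is at \<open>(k, x)\<close> in the other of the first two
        parts.\<close>
      have common: "k < q \<and> (\<exists>y<s. c (k, y) = c (i, x))" if x: "x < s" for x
      proof -
        obtain b y where b: "b < q" "y < s" "b \<noteq> i" "c (b, y) = c (i, x)" using neg x by blast
        then have "b = k" using k_cases[of b] ne[of b i y x] x i by auto
        then show ?thesis using b by auto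
      qed
      then have kq: "k < q" using common[of 0] s by simp
      have "inj_on (\<lambda>x. c (i, x)) {..<s}"
      proof (rule inj_onI)
        fix x x' assume x: "x \<in> {..<s}" "x' \<in> {..<s}" "c (i, x) = c (i, x')"
        obtain y where y: "y < s" "c (k, y) = c (i, x)" using common x by auto
        then have "y = x" using ne[of k i y x] x kq i k by auto
        moreover have "y = x'" using y ne[of k i y x'] x kq i k by auto
        ultimately show "x = x'" by simp
      qed
      moreover have "inj_on (\<lambda>b. c (b, 0)) {2..<q}"
        using ne s unfolding inj_on_def by (metis atLeastLessThan_iff gr0I not_numeral_le_zero order_less_le_trans zero_less_numeral)
      moreover have "(\<lambda>x. c (i, x)) ` {..<s} \<inter> (\<lambda>b. c (b, 0)) ` {2..<q} = {}"
        using ne[of i _ _ 0] i k s by fastforce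
      moreover have "c v \<in> {..<Suc q}" if "v \<in> {..<q} \<times> {..<s}" for v
        using c that unfolding colourings_def by (auto simp: PiE_iff)
      then have "(\<lambda>x. c (i, x)) ` {..<s} \<union> (\<lambda>b. c (b, 0)) ` {2..<q} \<subseteq> {..<Suc q}"
        using i s by auto
      then have "card ((\<lambda>x. c (i, x)) ` {..<s} \<union> (\<lambda>b. c (b, 0)) ` {2..<q}) \<le> Suc q"
        using card_mono[of "{..<Suc q}"] by simp
      ultimately have "s + (q - 2) \<le> Suc q" by (simp add: card_Un_disjoint card_image)
      then show False using s by simp
    qed
  qed
qed

text \<open>
  Every part has a private colour. At most one colour \<open>z\<close> remains, and its colour class is
  independent: it lies in one part or is one of the deleted edges.
\<close>

lemma card_colourings_H_graph:
  assumes s: "s \<ge> 4" and q: "q \<ge> 2"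
  shows "card (colourings (Suc q) (H_graph (Suc q) s l)) \<le> fact (Suc q) * (Suc q * 2 ^ s)"
proof -
  define V where "V = {..<q} \<times> {..<s}"
  define I where "I = {g \<in> {..<q} \<rightarrow>\<^sub>E {..<Suc q}. inj_on g {..<q}}"
  define W where "W = (\<Union>i<q. Pow ({i} \<times> {..<s})) \<union> (\<lambda>j. {(0, j), (1, j)}) ` {..<s}"
  \<comment> \<open>Rebuilds a colouring from its private colours \<open>g\<close> and the class
    \<open>X\<close> of the one colour outside the range of \<open>g\<close>, which the description
    operator names.\<close>
  define \<Psi> where "\<Psi> = (\<lambda>(g :: nat \<Rightarrow> nat, X). \<lambda>v\<in>V. if v \<in> X then THE z. {..<Suc q} - g ` {..<q} = {z} else g (fst v))"
  have "colourings (Suc q) (H_graph (Suc q) s l) \<subseteq> \<Psi> ` (I \<times> W)"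
  proof
    fix c assume c: "c \<in> colourings (Suc q) (H_graph (Suc q) s l)"
    then have ce: "c \<in> V \<rightarrow>\<^sub>E {..<Suc q}" unfolding colourings_def V_def by simp
    then have cq: "c v < Suc q" if "v \<in> V" for v using that by (auto simp: PiE_iff)
    have ne: "c (a, x) \<noteq> c (b, y)" if "a < q" "b < q" "x < s" "y < s" "a \<noteq> b" "x \<noteq> y \<or> a \<ge> 2 \<or> b \<ge> 2" for a b x y
      using c H_graph_edgeI[of a "Suc q" b x s y l] that unfolding colourings_def by auto
    obtain p where p: "\<And>i. i < q \<Longrightarrow> p i < s"
      and priv: "\<And>i i' y. i < q \<Longrightarrow> i' < q \<Longrightarrow> y < s \<Longrightarrow> i' \<noteq> i \<Longrightarrow> c (i', y) \<noteq> c (i, p i)"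
      using colouring_private_colour[OF c s] by metis
    define g where "g = (\<lambda>i\<in>{..<q}. c (i, p i))"
    have gi: "g i = c (i, p i)" if "i < q" for i using that unfolding g_def by simp
    have "inj_on g {..<q}"
    proof (rule inj_onI)
      fix i i' assume i: "i \<in> {..<q}" "i' \<in> {..<q}" "g i = g i'"
      show "i = i'"
      proof (rule ccontr)
        assume "i \<noteq> i'"
        then show False using priv[of i' i "p i"] p i gi by auto
      qed
    qed
    moreover have "g \<in> {..<q} \<rightarrow>\<^sub>E {..<Suc q}"
      unfolding g_def using cq p by (auto simp: V_def)
    ultimately have gI: "g \<in> I" and ginj: "inj_on g {..<q}" and gsub: "g ` {..<q} \<subseteq> {..<Suc q}"
      unfolding I_def by auto
    have "card ({..<Suc q} - g ` {..<q}) = 1"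
      using gsub card_image[OF ginj] by (simp add: card_Diff_subset)
    then obtain z where z: "{..<Suc q} - g ` {..<q} = {z}" by (auto simp: card_1_singleton_iff)
    define X where "X = {v \<in> V. c v = z}"
    have cval: "c (i, y) = z \<or> c (i, y) = g i" if "i < q" "y < s" for i y
    proof (cases "c (i, y) \<in> g ` {..<q}")
      case True
      then obtain i' where "i' < q" "c (i, y) = g i'" by auto
      then show ?thesis using priv[of i' i y] gi that by metis
    next
      case False
      then show ?thesis using z cq[of "(i, y)"] that unfolding V_def by auto
    qed
    have gz: "g i \<noteq> z" if "i < q" for i using z that by auto
    have "X \<in> W"
    proof (cases "\<exists>i<q. X \<subseteq> {i} \<times> {..<s}")
      case True
      then show ?thesis unfolding W_def by auto
    next
      case False
      have sub: "X \<subseteq> {..<q} \<times> {..<s}" unfolding X_def V_def by auto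
      then obtain a x where a: "(a, x) \<in> X" using False q by (metis empty_subsetI equals0I surj_pair less_le_trans pos2)
      then have aq: "a < q" "x < s" using sub by auto
      obtain b y where b: "(b, y) \<in> X" "b \<noteq> a" using False aq sub by blast
      then have bq: "b < q" "y < s" using sub by auto
      \<comment> \<open>Equally coloured vertices in different parts are not adjacent, which forces
        them into the first two parts at the same second coordinate.\<close>
      have diff: "x' = y' \<and> a' < 2 \<and> b' < 2" if "(a', x') \<in> X" "(b', y') \<in> X" "a' \<noteq> b'" for a' x' b' y'
      proof -
        have "c (a', x') = c (b', y')" "a' < q" "x' < s" "b' < q" "y' < s"
          using that unfolding X_def V_def by auto
        then show ?thesis using ne[of a' b' x' y'] that(3) by (meson not_less)
      qed
      have xy: "y = x" "a < 2" "b < 2" using diff[OF a b(1)] b(2) by auto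
      have "X = {(0, x), (1, x)}"
      proof (intro equalityI subsetI)
        fix v assume v: "v \<in> X"
        obtain d w where d: "v = (d, w)" by fastforce
        show "v \<in> {(0, x), (1, x)}"
        proof (cases "d = a")
          case True
          then have "w = x" using diff[of d w b y] v d b xy by auto
          then show ?thesis using d True xy by auto
        next
          case False
          then have "w = x" "d < 2" using diff[of d w a x] v d a by auto
          then show ?thesis using d by auto
        qed
      next
        fix v :: "nat \<times> nat" assume "v \<in> {(0, x), (1, x)}"
        then have "v = (a, x) \<or> v = (b, x)" using xy b(2) by auto
        then show "v \<in> X" using a b xy by auto
      qed
      then show ?thesis unfolding W_def using aq by auto
    qed
    moreover have "c = \<Psi> (g, X)"
    proof (rule PiE_ext)
      show "c \<in> V \<rightarrow>\<^sub>E UNIV" using ce by (auto simp: PiE_def)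
      show "\<Psi> (g, X) \<in> V \<rightarrow>\<^sub>E UNIV" unfolding \<Psi>_def by auto
      fix v assume v: "v \<in> V"
      obtain i y where iy: "v = (i, y)" "i < q" "y < s" using v unfolding V_def by auto
      have "(THE z. {..<Suc q} - g ` {..<q} = {z}) = z" using z by auto
      then have "\<Psi> (g, X) v = (if v \<in> X then z else g i)" using v iy unfolding \<Psi>_def by simp
      then show "c v = \<Psi> (g, X) v" using v cval[OF iy(2,3)] iy unfolding X_def by auto
    qed
    ultimately show "c \<in> \<Psi> ` (I \<times> W)" using gI by blast
  qed
  moreover have finI: "finite I" unfolding I_def
    by (rule finite_subset[of _ "{..<q} \<rightarrow>\<^sub>E {..<Suc q}"]) (auto intro!: finite_PiE)
  moreover have finW: "finite W" unfolding W_def by auto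
  ultimately have "card (colourings (Suc q) (H_graph (Suc q) s l)) \<le> card (I \<times> W)"
    using surj_card_le[of "I \<times> W" _ \<Psi>] by blast
  also have "\<dots> = card I * card W" by (rule card_cartesian_product)
  also have "card I = fact (Suc q)"
  proof -
    have "card I = (\<Prod>j<q. Suc q - j)" unfolding I_def by (subst card_injections) auto
    \<comment> \<open>The added factor is \<open>Suc q - q = 1\<close>.\<close>
    also have "\<dots> = (\<Prod>j<Suc q. Suc q - j)" by simp
    also have "\<dots> = fact (Suc q)" unfolding fact_prod_rev by (simp add: atLeast0LessThan)
    finally show ?thesis .
  qed
  also have "card W \<le> Suc q * 2 ^ s"
  proof -
    have "card (\<Union>i<q. Pow ({i} \<times> {..<s})) \<le> (\<Sum>i<q. card (Pow ({i} \<times> {..<s})))"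
      by (rule card_UN_le) simp
    also have "\<dots> = q * 2 ^ s" by (simp add: card_Pow card_cartesian_product)
    finally have "card (\<Union>i<q. Pow ({i} \<times> {..<s})) \<le> q * 2 ^ s" .
    \<comment> \<open>There are at most \<open>s <= 2 ^ s\<close> such pairs, so they count as one
      more part.\<close>
    moreover have "card ((\<lambda>j. {(0 :: nat, j), (1, j)}) ` {..<s}) \<le> 2 ^ s"
      by (rule order_trans[OF card_image_le]) (simp_all add: less_imp_le[OF less_exp])
    ultimately show ?thesis
      unfolding W_def using card_Un_le[of "\<Union>i<q. Pow ({i} \<times> {..<s})" "(\<lambda>j. {(0, j), (1, j)}) ` {..<s}"]
      by simp
  qed
  finally show ?thesis by simp
qed

section \<open>Comparison of the Turan graphs with \<open>q\<close> and \<open>q + 1\<close>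
  parts\<close>

text \<open>Pigeonhole on residues. This admits the Turan graph with \<open>q\<close> parts as a
  competitor of the one with \<open>q + 1\<close> parts.\<close>

lemma no_complete_copy_turan_graph:
  assumes "q > 0" "k > q"
  shows "copies (complete_graph k) (turan_graph q n) = {}"
proof (rule ccontr)
  assume "copies (complete_graph k) (turan_graph q n) \<noteq> {}"
  then obtain S where S: "is_subgraph S (turan_graph q n)" "graph_iso (complete_graph k) S"
    unfolding copies_def by auto
  then obtain f where f: "\<And>u v. u < k \<Longrightarrow> v < k \<Longrightarrow> {u, v} \<in> edges (complete_graph k) \<longleftrightarrow> {f u, f v} \<in> edges S"
    unfolding graph_iso_def by (auto simp: complete_graph_def)
  have "inj_on (\<lambda>u. f u mod q) {..<k}"
  proof (rule inj_onI, rule ccontr)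
    fix u v assume uv: "u \<in> {..<k}" "v \<in> {..<k}" "f u mod q = f v mod q" "u \<noteq> v"
    then have "{u, v} \<in> edges (complete_graph k)" unfolding complete_graph_def by auto
    then have "{f u, f v} \<in> edges (turan_graph q n)"
      using f uv S(1) unfolding is_subgraph_def by auto
    then show False using uv(3) unfolding edges_turan_graph_iff by simp
  qed
  moreover have "(\<lambda>u. f u mod q) ` {..<k} \<subseteq> {..<q}" using assms(1) by auto
  ultimately have "k \<le> q" using card_inj_on_le[of _ "{..<k}" "{..<q}"] by fastforce
  then show False using assms(2) by simp
qed

text \<open>Compares the leading coefficients of the two embedding counts: \<open>q + 1\<close>
  parts on the left, \<open>q\<close> parts on the right, both divided by \<open>q!\<close>.\<close>

lemma colouring_count_less:
  assumes q: "q \<ge> 2" and s: "int s \<ge> 12 * \<lceil>log 2 (real (Suc q))\<rceil>"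
  shows "real (Suc q) ^ 2 * 2 ^ s * real q ^ (s * q) < real (Suc q) ^ (s * q)"
proof -
  define L where "L = nat \<lceil>log 2 (real (Suc q))\<rceil>"
  have "log 2 (real (Suc q)) > 0" using q by simp
  then have "\<lceil>log 2 (real (Suc q))\<rceil> > 0" by (simp only: zero_less_ceiling)
  then have L: "int L = \<lceil>log 2 (real (Suc q))\<rceil>" and L0: "L > 0"
    unfolding L_def by (simp_all only: nat_0_le less_imp_le zero_less_nat_eq)
  have "log 2 (real (Suc q)) \<le> real L" using L by linarith
  then have "real (Suc q) \<le> 2 ^ L"
    by (simp add: log_le_iff powr_realpow)
  then have "real (Suc q) ^ 2 \<le> (2 ^ 2) ^ L" using power_mono[of "real (Suc q)" "2 ^ L" 2] by (simp only: power_mult[symmetric] mult.commute)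
  \<comment> \<open>The constant 12 of the hypothesis comes from here: it is the least exponent for
    which the power of 9/8 exceeds 4.\<close>
  also have "\<dots> < ((9/8) ^ 12) ^ L" by (rule power_strict_mono) (use L0 in \<open>auto simp: power_divide\<close>)
  also have "\<dots> = (9/8) ^ (12 * L)" by (simp only: power_mult)
  also have "\<dots> \<le> (9/8) ^ s" using s L by (intro power_increasing) auto
  finally have "real (Suc q) ^ 2 < (9/8) ^ s" .
  then have "real (Suc q) ^ 2 * 2 ^ s < (9/8) ^ s * 2 ^ s" by simp
  also have "\<dots> = (9/4) ^ s" by (simp flip: power_mult_distrib)
  finally have *: "real (Suc q) ^ 2 * 2 ^ s < (9/4) ^ s" .
  \<comment> \<open>The first three terms of the binomial expansion of \<open>(q + 1) ^ q\<close>
    suffice: relative to \<open>q ^ q\<close> they are 1, 1 and \<open>(q - 1) / (2 * q)\<close>,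
    and the last is at least 1/4 for \<open>q >= 2\<close>.\<close>
  have "9/4 * real q ^ q \<le> real (Suc q) ^ q"
  proof -
    obtain m where m: "q = Suc (Suc m)" using q by (metis Suc_le_D numeral_2_eq_2 Suc_le_mono)
    have "(\<Sum>k\<le>2. real (q choose k) * real q ^ (q - k)) \<le> (\<Sum>k\<le>q. real (q choose k) * real q ^ (q - k))"
      using q by (intro sum_mono2) auto
    also have "\<dots> = real (Suc q) ^ q"
      using binomial_ring[of 1 "real q" q] by (simp add: add.commute)
    also have "(\<Sum>k\<le>2. real (q choose k) * real q ^ (q - k)) =
        real q ^ q + real q * real q ^ (q - 1) + real (q choose 2) * real q ^ (q - 2)"
      by (simp add: numeral_2_eq_2)
    also have "real (q choose 2) = real q * (real q - 1) / 2"
      by (simp add: choose_two m real_of_nat_div field_simps)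
    finally have "real q ^ q + real q * real q ^ (q - 1) + real q * (real q - 1) / 2 * real q ^ (q - 2) \<le> real (Suc q) ^ q" .
    moreover have "real q * real q ^ (q - 1) = real q ^ q" by (simp add: m)
    moreover have "real q * (real q - 1) / 2 * real q ^ (q - 2) \<ge> real q * (real q / 2) / 2 * real q ^ (q - 2)"
      using q by (intro mult_right_mono divide_right_mono mult_left_mono) auto
    moreover have "real q * (real q / 2) / 2 * real q ^ (q - 2) = real q ^ q / 4"
      by (simp add: m)
    ultimately show ?thesis by simp
  qed
  then have "(9/4 * real q ^ q) ^ s \<le> (real (Suc q) ^ q) ^ s" by (intro power_mono) auto
  then have "(9/4) ^ s * real q ^ (s * q) \<le> real (Suc q) ^ (s * q)"
    by (simp only: power_mult_distrib mult.commute[of s q] power_mult)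
  moreover have "real (Suc q) ^ 2 * 2 ^ s * real q ^ (s * q) < (9/4) ^ s * real q ^ (s * q)"
    using * q by (intro mult_strict_right_mono) auto
  ultimately show ?thesis by linarith
qed

text \<open>Along suitable \<open>n\<close> proportional to \<open>m\<close>, both embedding counts
  are bounded by multiples of \<open>m ^ (s * q)\<close>. The strict inequality between the leading
  coefficients contradicts goodness once \<open>m\<close> is large.\<close>

lemma not_turan_good_H_graph:
  assumes q: "q \<ge> 2" and s: "int s \<ge> 12 * \<lceil>log 2 (real (Suc q))\<rceil>" and s4: "s \<ge> 4"
  shows "\<not> turan_good (Suc q) (H_graph (Suc q) s l)"
proof
  define H where "H = H_graph (Suc q) s l"
  define r where "r = Suc q"
  assume "turan_good (Suc q) (H_graph (Suc q) s l)"
  then obtain N where N: "\<And>n G. n \<ge> N \<Longrightarrow> simple_graph (G :: nat ugraph) \<Longrightarrow> card (verts G) = n \<Longrightarrow>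
      copies (complete_graph (r + 1)) G = {} \<Longrightarrow> num_copies H G \<le> num_copies H (turan_graph r n)"
    unfolding turan_good_def eventually_sequentially H_def r_def by blast
  define C where "C = real r ^ 2 * 2 ^ s * real q ^ (s * q)"
  \<comment> \<open>The base is \<open>(r * m - s) / m\<close>, the lower bound for one factor of
    the falling factorials after division by \<open>m\<close>.\<close>
  have "(\<lambda>m. (real r - real s / real m) ^ (s * q)) \<longlonglongrightarrow> (real r - 0) ^ (s * q)"
    by (intro tendsto_intros lim_const_over_n)
  moreover have "C < (real r - 0) ^ (s * q)"
    using colouring_count_less[OF q s] unfolding C_def r_def by simp
  ultimately have "\<forall>\<^sub>F m in sequentially. C < (real r - real s / real m) ^ (s * q)"
    by (rule order_tendstoD)
  then have "\<forall>\<^sub>F m in sequentially. C < (real r - real s / real m) ^ (s * q) \<and> N \<le> m \<and> s \<le> m \<and> 0 < m"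
    by (intro eventually_conj eventually_ge_at_top eventually_gt_at_top)
  then obtain m where m: "C < (real r - real s / real m) ^ (s * q)" "N \<le> m" "s \<le> m" "0 < m"
    unfolding eventually_sequentially by blast
  \<comment> \<open>Divisible by both \<open>q\<close> and \<open>r\<close>, so both Turan graphs
    have equal classes: of size \<open>r * m\<close> for \<open>q\<close> parts and
    \<open>q * m\<close> for \<open>r\<close> parts.\<close>
  define n where "n = r * (q * m)"
  have "m \<le> q * m" "q * m \<le> n" unfolding n_def r_def using q by auto
  then have nN: "n \<ge> N" using m(2) by linarith
  have "num_copies H (turan_graph q n) \<le> num_copies H (turan_graph r n)"
    using q by (intro N[OF nN] simple_graph_turan_graph no_complete_copy_turan_graph) (auto simp: r_def)
  then have "card (embeddings H (turan_graph q n)) \<le> card (embeddings H (turan_graph r n))"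
    using num_copies_le_iff simple_graph_H_graph simple_graph_turan_graph H_def by metis
  also have "\<dots> \<le> card (colourings r H) * (q * m) ^ card (verts H)"
    unfolding n_def H_def by (rule card_embeddings_turan_le) (auto simp: simple_graph_H_graph r_def)
  also have "\<dots> \<le> fact r * (r * 2 ^ s) * (q * m) ^ card (verts H)"
    using card_colourings_H_graph[OF s4 q, of l] unfolding r_def H_def by (intro mult_right_mono) auto
  also have "card (verts H) = s * q" unfolding H_def by (simp add: card_cartesian_product)
  also have "fact r = r * fact q" unfolding r_def by simp
  finally have upper: "card (embeddings H (turan_graph q n)) \<le> r * fact q * (r * 2 ^ s) * (q * m) ^ (s * q)"
    by simp
  \<comment> \<open>Each of the \<open>s * q\<close> factors of the falling factorials is bounded
    below by \<open>r * m - s\<close>.\<close>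
  have "fact q * (r * m - s) ^ (s * q) = fact q * (\<Prod>i<q. \<Prod>j<s. r * m - s)"
    by (simp add: power_mult)
  also have "\<dots> \<le> fact q * (\<Prod>i<q. \<Prod>j<s. (n + (q - 1 - i)) div q - j)"
  proof (intro mult_left_mono prod_mono conjI)
    fix i j assume ij: "i \<in> {..<q}" "j \<in> {..<s}"
    have "(n + (q - 1 - i)) div q = r * m + (q - 1 - i) div q"
      unfolding n_def using q by (simp add: mult.assoc mult.left_commute[of r q])
    then show "r * m - s \<le> (n + (q - 1 - i)) div q - j" using ij by simp
  qed auto
  also have "\<dots> \<le> card (embeddings H (turan_graph q n))"
    unfolding H_def using s4 by (intro card_embeddings_turan_ge) simp
  also note upper
  finally have "fact q * (r * m - s) ^ (s * q) \<le> fact q * (r ^ 2 * 2 ^ s * (q * m) ^ (s * q))"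
    by (simp add: power2_eq_square algebra_simps)
  then have "(r * m - s) ^ (s * q) \<le> r ^ 2 * 2 ^ s * (q * m) ^ (s * q)" by simp
  then have "real ((r * m - s) ^ (s * q)) \<le> real (r ^ 2 * 2 ^ s * (q * m) ^ (s * q))"
    by (rule of_nat_mono)
  moreover have "s \<le> r * m" using m(3) unfolding r_def by simp
  ultimately have "(real r * real m - real s) ^ (s * q) \<le> C * real m ^ (s * q)"
    unfolding C_def by (simp add: of_nat_diff power_mult_distrib algebra_simps)
  also have "(real r * real m - real s) = (real r - real s / real m) * real m"
    using m(4) by (simp add: field_simps)
  finally have "(real r - real s / real m) ^ (s * q) \<le> C"
    using m(4) by (simp add: power_mult_distrib)
  then show False using m(1) by simp
qed

theorem theorem1p8:
  fixes r s l :: nat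
  assumes "r \<ge> 3"
    and "int s \<ge> 12 * \<lceil>log 2 (real r)\<rceil>"
    and "l \<le> s"
  shows "turan_good (r - 1) (H_graph r s l) \<and> \<not> turan_good r (H_graph r s l)"
proof -
  obtain q where r: "r = Suc q" and q: "q \<ge> 2" using assms(1) by (cases r) auto
  have "log 2 (real r) > 0" using assms(1) by simp
  then have "\<lceil>log 2 (real r)\<rceil> \<ge> 1" by linarith
  \<comment> \<open>The resulting bound covers \<open>s >= 5\<close> and \<open>s >= 4\<close>,
    which the two halves ask for.\<close>
  then have "s \<ge> 12" using assms(2) by linarith
  then show ?thesis
    using turan_good_H_graph[of q s l] not_turan_good_H_graph[of q s l] assms(2) q unfolding r by simp
qed

end
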